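(* Let $d\ge 3$ and let $\mu$ be the measure on $\mathbb{R}^d$ which is the sum of the one-dimensional Lebesgue (arc length) measure on the segment $[0,1]\times\{0\}^{d-1}$ and the $(d-1)$-dimensional Lebesgue (area) measure on $\{0\}\times[0,1]^{d-1}$. Then $L^2(\mu)$ admits a Fourier frame. In particular, there is a measure on $\mathbb{R}^d$ which is the sum of the arc length measure on a curve and the area measure on a hypersurface and whose $L^2$ space admits a Fourier frame.
   Context: For $\lambda\in\mathbb{R}^d$ let $e_\lambda(x)=e^{2\pi i\langle\lambda,x\rangle}$. For a positive finite Borel measure $\mu$ on $\mathbb{R}^d$ and a countable set $\Lambda\subset\mathbb{R}^d$, the system $E(\Lambda)=\{e_\lambda\}_{\lambda\in\Lambda}$ is a Fourier frame for $L^2(\mu)$ if there are constants $0<A,B<\infty$ with $A\|f\|^2_{L^2(\mu)}\le\sum_{\lambda\in\Lambda}|\langle f,e_\lambda\rangle_{L^2(\mu)}|^2\le B\|f\|^2_{L^2(\mu)}$ for all $f\in L^2(\mu)$. "$L^2(\mu)$ admits a Fourier frame" means such a $\Lambda$ exists. *)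

theory Defs
  imports "HOL-Analysis.Analysis"
begin

definition measure_sum :: "'a measure \<Rightarrow> 'a measure \<Rightarrow> 'a measure" where
  "measure_sum M N = measure_of (space M) (sets M) (\<lambda>A. emeasure M A + emeasure N A)"

definition expo :: "real ^ 'n \<Rightarrow> real ^ 'n \<Rightarrow> complex" where
  "expo lam x = cis (2 * pi * (lam \<bullet> x))"

definition in_L2 :: "'a measure \<Rightarrow> ('a \<Rightarrow> complex) \<Rightarrow> bool" where
  "in_L2 M f \<longleftrightarrow> f \<in> borel_measurable M \<and> integrable M (\<lambda>x. (cmod (f x))\<^sup>2)"

definition L2_norm_sq :: "'a measure \<Rightarrow> ('a \<Rightarrow> complex) \<Rightarrow> real" where
  "L2_norm_sq M f = (\<integral>x. (cmod (f x))\<^sup>2 \<partial>M)"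

definition L2_inner :: "'a measure \<Rightarrow> ('a \<Rightarrow> complex) \<Rightarrow> ('a \<Rightarrow> complex) \<Rightarrow> complex" where
  "L2_inner M f g = (\<integral>x. f x * cnj (g x) \<partial>M)"

definition fourier_frame :: "(real ^ 'n) measure \<Rightarrow> (real ^ 'n) set \<Rightarrow> bool" where
  "fourier_frame M Lam \<longleftrightarrow> countable Lam \<and>
     (\<exists>A B. 0 < A \<and> A < \<infinity> \<and> 0 < B \<and> B < \<infinity> \<and>
        (\<forall>f. in_L2 M f \<longrightarrow>
            A * ennreal (L2_norm_sq M f)
              \<le> (\<Sum>\<^sub>\<infinity>lam\<in>Lam. ennreal ((cmod (L2_inner M f (expo lam)))\<^sup>2))
          \<and> (\<Sum>\<^sub>\<infinity>lam\<in>Lam. ennreal ((cmod (L2_inner M f (expo lam)))\<^sup>2))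
              \<le> B * ennreal (L2_norm_sq M f)))"

definition admits_fourier_frame :: "(real ^ 'n) measure \<Rightarrow> bool" where
  "admits_fourier_frame M \<longleftrightarrow> (\<exists>Lam. fourier_frame M Lam)"

definition segment_measure :: "'n \<Rightarrow> (real ^ 'n) measure" where
  "segment_measure i = distr (restrict_space lborel {0..1}) borel
      (\<lambda>t. \<chi> j. if j = i then t else 0)"

definition face_measure :: "'n \<Rightarrow> (real ^ 'n) measure" where
  "face_measure i = distr (PiM (UNIV - {i}) (\<lambda>_. restrict_space lborel {0..1})) borel
      (\<lambda>y. \<chi> j. if j = i then 0 else y j)"

end

(*
On the segment only one coordinate of a frequency matters, on the face only the others, so with
lam = u + v the coefficient of f is F(u) + G(v), where F and G are the coefficients of f on the two
pieces. The integer frequencies u and v give orthonormal bases of the two L2 spaces. Pairing u(n div 4)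
with v(n) repeats every F(u) four times but uses every G(v) once, so |x|^2 <= 2|x + y|^2 + 2|y|^2 shows
that these pairs control 2 |F|^2 - |G|^2 in l2; exchanging the roles controls 2 |G|^2 - |F|^2, and the
union of both families of pairs is a frame.

Completeness of the exponentials holds for every finite measure on the half-open unit cube:
Stone-Weierstrass on the image of the cube in a product of circles approximates indicators of open sets,
a Dynkin argument extends this to Borel sets, and the half-open cube is recovered by the argument function.
*)
theory Submission
  imports Defs "HOL-Probability.Infinite_Product_Measure"
begin

text \<open>The two pieces cannot be given their frequencies separately. A frequency u in the
  direction of the segment equals 1 on the face, so using all u alone adds one fixed number G(0) to
  infinitely many coefficients, and the sum of squares diverges. Hence every frequency of one basis
  may recur only boundedly often. A one-to-one pairing of the two bases fails for the opposite
  reason: there is an f with F(u) = - G(v) on all pairs, and every coefficient vanishes.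

  Repetition resolves both. If each F(u) occurs d times and each G(v) once, the sum of squares is at
  least (d/2) |F|^2 - |G|^2. Adding the bound with the roles exchanged gives (d/2 - 1) (|F|^2 +
  |G|^2), positive once d > 2; the value d = 4 makes the factor 1.

  The dimensions of the pieces do not enter the pairing: both bases are countably infinite, so
  enumerations by natural numbers can be matched. This is why a curve and a hypersurface can share a
  frame.\<close>

section \<open>Trigonometric polynomials with integer frequencies\<close>

definition int_vecs :: "(real ^ 'n) set" where
  "int_vecs = {k. \<forall>j. k $ j \<in> \<int>}"

text \<open>Inductive closure instead of explicit finite sums: products, measurability and
  boundedness follow by induction without handling coefficients. Coefficients become necessary only
  in \<open>trig_poly_expansion\<close>.\<close>

inductive_set trig_poly :: "(real ^ 'n \<Rightarrow> complex) set" where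
  base: "k \<in> int_vecs \<Longrightarrow> expo k \<in> trig_poly"
| add: "p \<in> trig_poly \<Longrightarrow> q \<in> trig_poly \<Longrightarrow> (\<lambda>x. p x + q x) \<in> trig_poly"
| scale: "p \<in> trig_poly \<Longrightarrow> (\<lambda>x. c * p x) \<in> trig_poly"

lemma expo_add: "expo (k + l) x = expo k x * expo l x"
  by (simp add: expo_def inner_left_distrib cis_mult distrib_left)

lemma norm_expo [simp]: "cmod (expo k x) = 1"
  by (simp add: expo_def)

lemma expo_zero [simp]: "expo 0 x = 1"
  by (simp add: expo_def)

lemma expo_measurable [measurable]: "expo k \<in> borel_measurable borel"
  unfolding expo_def by (intro borel_measurable_continuous_onI continuous_intros)

lemma int_vecs_add: "k \<in> int_vecs \<Longrightarrow> l \<in> int_vecs \<Longrightarrow> k + l \<in> int_vecs"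
  by (simp add: int_vecs_def)

lemma trig_poly_const: "(\<lambda>x. c) \<in> trig_poly"
proof -
  have "expo 0 \<in> trig_poly" by (rule trig_poly.base) (simp add: int_vecs_def)
  from trig_poly.scale[OF this, of c] show ?thesis by simp
qed

lemma trig_poly_mult:
  assumes p: "p \<in> trig_poly" and q: "q \<in> trig_poly"
  shows "(\<lambda>x. p x * q x) \<in> trig_poly"
  using p
proof induction
  case (base k)
  show ?case using q
  proof induction
    case (base l)
    have "(\<lambda>x. expo k x * expo l x) = expo (k + l)" by (simp add: expo_add fun_eq_iff)
    then show ?case using base \<open>k \<in> int_vecs\<close> by (simp add: trig_poly.base int_vecs_add)
  next
    case (add p q)
    from trig_poly.add[OF add.IH] show ?case by (simp add: distrib_left)
  next
    case (scale p c)
    from trig_poly.scale[OF scale.IH, of c] show ?case by (simp add: mult.left_commute)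
  qed
next
  case (add p q)
  from trig_poly.add[OF add.IH] show ?case by (simp add: distrib_right)
next
  case (scale p c)
  from trig_poly.scale[OF scale.IH, of c] show ?case by (simp add: mult.assoc)
qed

lemma trig_poly_sum:
  assumes "finite I" "\<And>i. i \<in> I \<Longrightarrow> p i \<in> trig_poly"
  shows "(\<lambda>x. \<Sum>i\<in>I. p i x) \<in> trig_poly"
  using assms
proof (induction I rule: finite_induct)
  case empty
  show ?case by (simp add: trig_poly_const)
next
  case (insert i I)
  then have "p i \<in> trig_poly" "(\<lambda>x. \<Sum>i\<in>I. p i x) \<in> trig_poly" by blast+
  from trig_poly.add[OF this] insert.hyps show ?case by simp
qed

lemma trig_poly_measurable: "p \<in> trig_poly \<Longrightarrow> p \<in> borel_measurable borel"
  by (induction rule: trig_poly.induct) auto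

lemma trig_poly_bounded: "p \<in> trig_poly \<Longrightarrow> \<exists>B. \<forall>x. cmod (p x) \<le> B"
proof (induction rule: trig_poly.induct)
  case (base k)
  then show ?case by (intro exI[of _ 1]) simp
next
  case (add p q)
  then obtain B C where "\<And>x. cmod (p x) \<le> B" "\<And>x. cmod (q x) \<le> C" by blast
  then show ?case by (intro exI[of _ "B + C"]) (blast intro: norm_triangle_le add_mono)
next
  case (scale p c)
  then obtain B where "\<And>x. cmod (p x) \<le> B" by blast
  then show ?case by (intro exI[of _ "cmod c * B"]) (auto simp: norm_mult intro: mult_left_mono)
qed

section \<open>The cube as a product of circles\<close>

definition torus_map :: "real ^ 'n \<Rightarrow> complex ^ 'n" where
  "torus_map x = (\<chi> j. cis (2 * pi * x $ j))"

lemma torus_map_measurable [measurable]: "torus_map \<in> borel_measurable borel"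
  unfolding torus_map_def by (intro borel_measurable_continuous_onI continuous_intros)

text \<open>By Euler's formula: the real coordinates of a point on the torus are cosines and sines,
  that is, combinations of the exponentials with frequencies plus and minus a unit vector.\<close>

lemma torus_coordinate_trig_poly:
  fixes b :: "complex ^ 'n"
  assumes "b \<in> Basis"
  shows "(\<lambda>x. complex_of_real (torus_map x \<bullet> b)) \<in> trig_poly"
proof -
  from assms obtain j u where b: "b = axis j u" and u: "u = 1 \<or> u = \<i>"
    by (auto simp: Basis_vec_def Basis_complex_def)
  let ?k = "axis j 1 :: real ^ 'n"
  have pos: "expo ?k \<in> trig_poly" and neg: "expo (- ?k) \<in> trig_poly"
    by (auto intro!: trig_poly.base simp: int_vecs_def axis_def)
  have val: "torus_map x \<bullet> b = cis (2 * pi * x $ j) \<bullet> u" for x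
    by (simp add: b inner_axis torus_map_def)
  have e: "expo ?k x = cis (2 * pi * x $ j)" "expo (- ?k) x = cis (- (2 * pi * x $ j))" for x
    by (simp_all add: expo_def inner_axis')
  show ?thesis using u
  proof
    assume [simp]: "u = 1"
    have "(\<lambda>x. complex_of_real (torus_map x \<bullet> b)) = (\<lambda>x. 1/2 * expo ?k x + 1/2 * expo (- ?k) x)"
      by (simp add: val e fun_eq_iff complex_eq_iff inner_complex_def)
    moreover have "\<dots> \<in> trig_poly" by (rule trig_poly.add[OF trig_poly.scale[OF pos] trig_poly.scale[OF neg]])
    ultimately show ?thesis by (simp only:)
  next
    assume [simp]: "u = \<i>"
    have "(\<lambda>x. complex_of_real (torus_map x \<bullet> b)) = (\<lambda>x. (- \<i>/2) * expo ?k x + (\<i>/2) * expo (- ?k) x)"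
      by (simp add: val e fun_eq_iff complex_eq_iff inner_complex_def)
    moreover have "\<dots> \<in> trig_poly" by (rule trig_poly.add[OF trig_poly.scale[OF pos] trig_poly.scale[OF neg]])
    ultimately show ?thesis by (simp only:)
  qed
qed

text \<open>Links the real form of Stone-Weierstrass to exponentials: its approximants are real
  polynomials in the real and imaginary parts of the circle coordinates, and those coordinates are
  trigonometric polynomials.\<close>

lemma polynomial_on_torus_trig_poly:
  assumes "real_polynomial_function p"
  shows "(\<lambda>x. complex_of_real (p (torus_map x))) \<in> trig_poly"
  using assms
proof induction
  case (linear f)
  then interpret bounded_linear f .
  have rep: "f z = (\<Sum>b\<in>Basis. (z \<bullet> b) * f b)" for z
  proof -
    have "f z = f (\<Sum>b\<in>Basis. (z \<bullet> b) *\<^sub>R b)" by (simp add: euclidean_representation)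
    also have "\<dots> = (\<Sum>b\<in>Basis. (z \<bullet> b) * f b)" by (simp add: sum scaleR)
    finally show ?thesis .
  qed
  have "(\<lambda>x. complex_of_real (f (torus_map x)))
      = (\<lambda>x. \<Sum>b\<in>Basis. of_real (f b) * complex_of_real (torus_map x \<bullet> b))"
    by (rule ext, subst rep) (simp add: mult.commute)
  moreover have "\<dots> \<in> trig_poly"
    by (rule trig_poly_sum, simp, rule trig_poly.scale, erule torus_coordinate_trig_poly)
  ultimately show ?case by (simp only:)
next
  case (const c)
  show ?case by (rule trig_poly_const)
next
  case (add f g)
  from trig_poly.add[OF add.IH] show ?case by simp
next
  case (mult f g)
  from trig_poly_mult[OF mult.IH] show ?case by simp
qed

lemma continuous_on_torus_approx:
  fixes h :: "complex ^ 'n \<Rightarrow> real"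
  assumes "continuous_on UNIV h" "0 < e"
  obtains p where "p \<in> trig_poly" "\<And>x. cmod (of_real (h (torus_map x)) - p x) < e"
proof -
  \<comment> \<open>Any compact set containing the torus will do, since \<open>h\<close> is defined
    everywhere. The radius is the sum of the moduli of the coordinates, each equal to 1.\<close>
  define S :: "(complex ^ 'n) set" where "S = cball 0 (real CARD('n))"
  have S: "torus_map x \<in> S" for x
  proof -
    have "norm (torus_map x) \<le> (\<Sum>j\<in>UNIV. norm (torus_map x $ j))"
      unfolding norm_vec_def by (rule L2_set_le_sum) simp
    then show ?thesis by (simp add: S_def torus_map_def)
  qed
  have "compact S" "continuous_on S h" using assms(1) by (auto simp: S_def intro: continuous_on_subset)
  from Stone_Weierstrass_real_polynomial_function[OF this assms(2)] obtain g
    where g: "real_polynomial_function g" "\<And>z. z \<in> S \<Longrightarrow> \<bar>h z - g z\<bar> < e" by blast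
  show ?thesis
  proof
    show "(\<lambda>x. complex_of_real (g (torus_map x))) \<in> trig_poly"
      by (rule polynomial_on_torus_trig_poly[OF g(1)])
    show "cmod (of_real (h (torus_map x)) - of_real (g (torus_map x))) < e" for x
      using g(2)[OF S, of x] by (simp flip: of_real_diff)
  qed
qed

text \<open>\<open>Arg2pi\<close> has values in [0, 2 pi), so on the torus this picks the
  representative in the half-open cube; on the closed cube no inverse exists, because
  \<open>torus_map\<close> glues opposite faces.\<close>

definition torus_inv :: "complex ^ 'n \<Rightarrow> real ^ 'n" where
  "torus_inv z = (\<chi> j. Arg2pi (z $ j) / (2 * pi))"

text \<open>The argument is continuous off the closed nonnegative real axis and equals 0 on it, so
  it is a continuous function on an open set glued to a constant.\<close>

lemma Arg2pi_measurable [measurable]: "Arg2pi \<in> borel_measurable borel"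
proof -
  have eq: "Arg2pi = (\<lambda>z. if z \<in> - \<real>\<^sub>\<ge>\<^sub>0 then Arg2pi z else 0)"
    by (auto simp: fun_eq_iff Arg2pi_eq_0 complex_nonneg_Reals_iff complex_is_Real_iff)
  have "continuous_on (- \<real>\<^sub>\<ge>\<^sub>0) Arg2pi"
    by (auto intro!: continuous_at_imp_continuous_on continuous_at_Arg2pi)
  then show ?thesis
    by (subst eq, intro borel_measurable_continuous_on_if) (auto intro!: borel_open)
qed

lemma torus_inv_measurable [measurable]: "torus_inv \<in> borel_measurable borel"
proof (rule borel_measurable_euclidean_space[THEN iffD2], intro ballI)
  fix b :: "real ^ 'n" assume "b \<in> Basis"
  then obtain j where b: "b = axis j 1" by (auto simp: Basis_vec_def)
  have "(\<lambda>z. torus_inv z \<bullet> b) = (\<lambda>z. Arg2pi (z $ j) / (2 * pi))"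
    by (simp add: b inner_axis torus_inv_def)
  moreover have "(\<lambda>z::complex ^ 'n. z $ j) \<in> borel_measurable borel"
    by (intro borel_measurable_continuous_onI continuous_intros)
  ultimately show "(\<lambda>z. torus_inv z \<bullet> b) \<in> borel_measurable borel"
    by simp
qed

lemma torus_inv_torus_map:
  assumes "\<And>j. 0 \<le> x $ j \<and> x $ j < 1"
  shows "torus_inv (torus_map x) = x"
proof -
  have "Arg2pi (cis (2 * pi * x $ j)) = 2 * pi * x $ j" for j
    using assms[of j] by (intro Arg2pi_unique[of 1]) (auto simp: cis_conv_exp)
  then show ?thesis by (simp add: torus_inv_def torus_map_def vec_eq_iff)
qed

section \<open>Square-integrable functions and dominated convergence\<close>

lemma norm_add_sq_le: "(cmod (a + b))\<^sup>2 \<le> 2 * (cmod a)\<^sup>2 + 2 * (cmod b)\<^sup>2"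
proof -
  have "(cmod (a + b))\<^sup>2 \<le> (cmod a + cmod b)\<^sup>2"
    by (intro power_mono norm_triangle_ineq) simp
  also have "\<dots> \<le> 2 * (cmod a)\<^sup>2 + 2 * (cmod b)\<^sup>2"
    using sum_squares_bound[of "cmod a" "cmod b"] by (simp add: power2_sum)
  finally show ?thesis .
qed

lemma norm_diff_sq_le: "(cmod (a - b))\<^sup>2 \<le> 2 * (cmod a)\<^sup>2 + 2 * (cmod b)\<^sup>2"
  using norm_add_sq_le[of a "- b"] by simp

lemma in_L2_measurable: "in_L2 M f \<Longrightarrow> f \<in> borel_measurable M"
  by (simp add: in_L2_def)

lemma in_L2_dominated:
  assumes "f \<in> borel_measurable M" "integrable M w" "AE x in M. (cmod (f x))\<^sup>2 \<le> w x"
  shows "in_L2 M f"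
proof -
  have "integrable M (\<lambda>x. (cmod (f x))\<^sup>2)"
    by (rule Bochner_Integration.integrable_bound[OF assms(2)]) (use assms in auto)
  with assms show ?thesis by (simp add: in_L2_def)
qed

lemma in_L2_add:
  assumes "in_L2 M f" "in_L2 M g"
  shows "in_L2 M (\<lambda>x. f x + g x)"
proof (rule in_L2_dominated)
  show "integrable M (\<lambda>x. 2 * (cmod (f x))\<^sup>2 + 2 * (cmod (g x))\<^sup>2)"
    using assms by (simp add: in_L2_def)
qed (use assms in \<open>auto simp: in_L2_def norm_add_sq_le\<close>)

lemma in_L2_scale:
  assumes "in_L2 M f"
  shows "in_L2 M (\<lambda>x. c * f x)"
  using assms by (auto simp: in_L2_def norm_mult power_mult_distrib)

lemma in_L2_diff:
  assumes "in_L2 M f" "in_L2 M g"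
  shows "in_L2 M (\<lambda>x. f x - g x)"
  using in_L2_add[OF assms(1) in_L2_scale[OF assms(2), of "-1"]] by simp

lemma L2_norm_sq_add_le:
  assumes "in_L2 M f" "in_L2 M g"
  shows "L2_norm_sq M (\<lambda>x. f x + g x) \<le> 2 * L2_norm_sq M f + 2 * L2_norm_sq M g"
proof -
  have "L2_norm_sq M (\<lambda>x. f x + g x) \<le> (\<integral>x. 2 * (cmod (f x))\<^sup>2 + 2 * (cmod (g x))\<^sup>2 \<partial>M)"
    unfolding L2_norm_sq_def using in_L2_add[OF assms] assms
    by (intro integral_mono) (auto simp: in_L2_def norm_add_sq_le)
  also have "\<dots> = 2 * L2_norm_sq M f + 2 * L2_norm_sq M g"
    using assms by (simp add: in_L2_def L2_norm_sq_def)
  finally show ?thesis .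
qed

lemma L2_norm_sq_nonneg [simp]: "0 \<le> L2_norm_sq M f"
  by (simp add: L2_norm_sq_def)

lemma L2_norm_sq_scale: "L2_norm_sq M (\<lambda>x. c * f x) = (cmod c)\<^sup>2 * L2_norm_sq M f"
  by (simp add: L2_norm_sq_def norm_mult power_mult_distrib)

text \<open>The majorant passes from the sequence to its almost everywhere limit, so the limit is in
  L2 and the squared differences have an integrable majorant of their own.\<close>

lemma L2_norm_sq_dominated_convergence:
  assumes s: "\<And>n. s n \<in> borel_measurable M" and f: "f \<in> borel_measurable M"
    and w: "integrable M (\<lambda>x. (w x)\<^sup>2)"
    and lim: "AE x in M. (\<lambda>n. s n x) \<longlonglongrightarrow> f x"
    and bound: "\<And>n. AE x in M. cmod (s n x) \<le> w x"
  shows "in_L2 M f" and "(\<lambda>n. L2_norm_sq M (\<lambda>x. f x - s n x)) \<longlonglongrightarrow> 0"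
proof -
  have bd: "AE x in M. cmod (f x) \<le> w x \<and> (\<forall>n. cmod (s n x) \<le> w x)"
  proof -
    have "AE x in M. \<forall>n. cmod (s n x) \<le> w x" using bound by (simp add: AE_all_countable)
    with lim show ?thesis
    proof eventually_elim
      case (elim x)
      have "(\<lambda>n. cmod (s n x)) \<longlonglongrightarrow> cmod (f x)" using elim(1) by (rule tendsto_norm)
      then have "cmod (f x) \<le> w x" by (rule LIMSEQ_le_const2) (use elim(2) in blast)
      with elim(2) show ?case by blast
    qed
  qed
  show "in_L2 M f"
    by (rule in_L2_dominated[OF f w]) (use bd in eventually_elim, auto intro: power_mono)
  have "(\<lambda>n. \<integral>x. (cmod (f x - s n x))\<^sup>2 \<partial>M) \<longlonglongrightarrow> (\<integral>x. 0 \<partial>M)"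
  proof (rule integral_dominated_convergence)
    \<comment> \<open>The factor 4 is 2 + 2 from \<open>norm_diff_sq_le\<close>, with both functions
      bounded by \<open>w\<close>.\<close>
    show "integrable M (\<lambda>x. 4 * (w x)\<^sup>2)" using w by simp
    show "AE x in M. (\<lambda>n. (cmod (f x - s n x))\<^sup>2) \<longlonglongrightarrow> 0"
      using lim
    proof eventually_elim
      case (elim x)
      have "(\<lambda>n. (cmod (f x - s n x))\<^sup>2) \<longlonglongrightarrow> (cmod (f x - f x))\<^sup>2"
        by (intro tendsto_intros elim)
      then show ?case by simp
    qed
    show "AE x in M. norm ((cmod (f x - s n x))\<^sup>2) \<le> 4 * (w x)\<^sup>2" for n
      using bd
    proof eventually_elim
      case (elim x)
      have "(cmod (f x))\<^sup>2 \<le> (w x)\<^sup>2" "(cmod (s n x))\<^sup>2 \<le> (w x)\<^sup>2"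
        using elim by (auto intro: power_mono)
      with norm_diff_sq_le[of "f x" "s n x"] show ?case by simp
    qed
  qed (use s f in auto)
  then show "(\<lambda>n. L2_norm_sq M (\<lambda>x. f x - s n x)) \<longlonglongrightarrow> 0"
    by (simp add: L2_norm_sq_def)
qed

section \<open>Density of trigonometric polynomials in L2 of a measure on the cube\<close>

definition trig_approx :: "(real ^ 'n) measure \<Rightarrow> (real ^ 'n \<Rightarrow> complex) \<Rightarrow> bool" where
  "trig_approx M f \<longleftrightarrow> in_L2 M f \<and>
     (\<forall>e>0. \<exists>p\<in>trig_poly. L2_norm_sq M (\<lambda>x. f x - p x) < e)"

text \<open>The measure stays on the whole space and the half-open cube enters only almost
  everywhere. This admits the segment and the face, which are built from closed intervals: the
  endpoint 1 is a null set.\<close>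

locale cube_measure = finite_measure M for M :: "(real ^ 'n) measure" +
  assumes sets_M [measurable_cong]: "sets M = sets borel"
    and AE_cube: "AE x in M. \<forall>j. 0 \<le> x $ j \<and> x $ j < 1"
begin

lemma in_L2_bounded:
  assumes "f \<in> borel_measurable M" "\<And>x. cmod (f x) \<le> B"
  shows "in_L2 M f"
proof (rule in_L2_dominated[OF assms(1)])
  show "integrable M (\<lambda>x. B\<^sup>2)" by simp
  show "AE x in M. (cmod (f x))\<^sup>2 \<le> B\<^sup>2" by (intro AE_I2 power_mono assms(2)) simp
qed

lemma measurable_borel_M: "f \<in> borel_measurable borel \<Longrightarrow> f \<in> borel_measurable M"
  by (simp add: measurable_cong_sets[OF sets_M refl])

lemma measurable_torus_map:
  "g \<in> borel_measurable borel \<Longrightarrow> (\<lambda>x. g (torus_map x)) \<in> borel_measurable M"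
  by (intro measurable_borel_M measurable_compose[OF torus_map_measurable])

lemma in_L2_trig_poly: "p \<in> trig_poly \<Longrightarrow> in_L2 M p"
  using trig_poly_bounded[of p] in_L2_bounded[of p] measurable_borel_M[OF trig_poly_measurable] by blast

text \<open>\<open>trig_approx\<close> describes the L2 closure of the trigonometric polynomials,
  and a closure is closed. With squared norms the triangle inequality costs a factor 2, hence the
  tolerance \<open>e/4\<close> for each of the two errors.\<close>

lemma trig_approx_limit:
  assumes f: "in_L2 M f"
    and ex: "\<And>e. 0 < e \<Longrightarrow> \<exists>g. trig_approx M g \<and> L2_norm_sq M (\<lambda>x. f x - g x) < e"
  shows "trig_approx M f"
  unfolding trig_approx_def
proof (intro conjI allI impI f)
  fix e :: real assume "0 < e"
  with ex[of "e/4"] obtain g where g: "trig_approx M g" "L2_norm_sq M (\<lambda>x. f x - g x) < e/4" by auto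
  from g(1) \<open>0 < e\<close> obtain p where p: "p \<in> trig_poly" "L2_norm_sq M (\<lambda>x. g x - p x) < e/4"
    unfolding trig_approx_def by (metis zero_less_divide_iff zero_less_numeral)
  have gL: "in_L2 M g" using g(1) by (simp add: trig_approx_def)
  have "L2_norm_sq M (\<lambda>x. f x - p x) = L2_norm_sq M (\<lambda>x. (f x - g x) + (g x - p x))" by simp
  also have "\<dots> \<le> 2 * L2_norm_sq M (\<lambda>x. f x - g x) + 2 * L2_norm_sq M (\<lambda>x. g x - p x)"
    by (intro L2_norm_sq_add_le in_L2_diff f gL in_L2_trig_poly p)
  also have "\<dots> < e" using g p by simp
  finally show "\<exists>p\<in>trig_poly. L2_norm_sq M (\<lambda>x. f x - p x) < e" using p by blast
qed

lemma trig_approx_trig_poly: "p \<in> trig_poly \<Longrightarrow> trig_approx M p"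
  unfolding trig_approx_def by (auto intro!: in_L2_trig_poly bexI[of _ p] simp: L2_norm_sq_def)

lemma trig_approx_add:
  assumes "trig_approx M f" "trig_approx M g"
  shows "trig_approx M (\<lambda>x. f x + g x)"
  unfolding trig_approx_def
proof (intro conjI allI impI)
  have f: "in_L2 M f" and g: "in_L2 M g" using assms by (auto simp: trig_approx_def)
  then show "in_L2 M (\<lambda>x. f x + g x)" by (rule in_L2_add)
  fix e :: real assume "0 < e"
  then have "0 < e/4" by simp
  with assms obtain p q where p: "p \<in> trig_poly" "L2_norm_sq M (\<lambda>x. f x - p x) < e/4"
    and q: "q \<in> trig_poly" "L2_norm_sq M (\<lambda>x. g x - q x) < e/4"
    unfolding trig_approx_def by blast
  have "L2_norm_sq M (\<lambda>x. f x + g x - (p x + q x)) = L2_norm_sq M (\<lambda>x. (f x - p x) + (g x - q x))"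
    by (simp add: algebra_simps)
  also have "\<dots> \<le> 2 * L2_norm_sq M (\<lambda>x. f x - p x) + 2 * L2_norm_sq M (\<lambda>x. g x - q x)"
    by (intro L2_norm_sq_add_le in_L2_diff f g in_L2_trig_poly p q)
  also have "\<dots> < e" using p q by simp
  finally show "\<exists>p\<in>trig_poly. L2_norm_sq M (\<lambda>x. f x + g x - p x) < e"
    by (rule bexI[OF _ trig_poly.add[OF p(1) q(1)]])
qed

lemma trig_approx_scale:
  assumes "trig_approx M f"
  shows "trig_approx M (\<lambda>x. c * f x)"
  unfolding trig_approx_def
proof (intro conjI allI impI)
  show "in_L2 M (\<lambda>x. c * f x)" using assms by (auto simp: trig_approx_def intro: in_L2_scale)
  fix e :: real assume "0 < e"
  \<comment> \<open>The summand 1 keeps the denominator positive for c = 0 and makes the final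
    estimate strict.\<close>
  define d where "d = e / ((cmod c)\<^sup>2 + 1)"
  have "0 < (cmod c)\<^sup>2 + 1" by (simp add: add_nonneg_pos)
  with \<open>0 < e\<close> have d: "0 < d" "((cmod c)\<^sup>2 + 1) * d = e" by (auto simp: d_def)
  with assms obtain p where p: "p \<in> trig_poly" "L2_norm_sq M (\<lambda>x. f x - p x) < d"
    unfolding trig_approx_def by blast
  have "L2_norm_sq M (\<lambda>x. c * f x - c * p x) = (cmod c)\<^sup>2 * L2_norm_sq M (\<lambda>x. f x - p x)"
    by (simp flip: L2_norm_sq_scale right_diff_distrib)
  also have "\<dots> \<le> (cmod c)\<^sup>2 * d" using p by (intro mult_left_mono) auto
  also have "\<dots> < e" using d by (simp add: distrib_right)
  finally show "\<exists>p\<in>trig_poly. L2_norm_sq M (\<lambda>x. c * f x - p x) < e"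
    by (rule bexI[OF _ trig_poly.scale[OF p(1)]])
qed

lemma trig_approx_sum:
  assumes "finite I" "\<And>i. i \<in> I \<Longrightarrow> trig_approx M (f i)"
  shows "trig_approx M (\<lambda>x. \<Sum>i\<in>I. f i x)"
  using assms
proof (induction I rule: finite_induct)
  case empty
  show ?case using trig_approx_trig_poly[OF trig_poly_const[of 0]] by simp
next
  case (insert i I)
  then have "trig_approx M (f i)" "trig_approx M (\<lambda>x. \<Sum>i\<in>I. f i x)" by blast+
  from trig_approx_add[OF this] insert.hyps show ?case by simp
qed

text \<open>The common tool for every enlargement below, from uniform limits and open sets through
  disjoint unions to general L2 functions: each is a pointwise limit under a square-integrable
  majorant.\<close>

lemma trig_approx_dominated:
  assumes s: "\<And>n. trig_approx M (s n)" and f: "f \<in> borel_measurable M"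
    and w: "integrable M (\<lambda>x. (w x)\<^sup>2)"
    and lim: "AE x in M. (\<lambda>n. s n x) \<longlonglongrightarrow> f x"
    and bound: "\<And>n. AE x in M. cmod (s n x) \<le> w x"
  shows "trig_approx M f"
proof (rule trig_approx_limit)
  have sm: "s n \<in> borel_measurable M" for n using s[of n] by (simp add: trig_approx_def in_L2_def)
  note L = L2_norm_sq_dominated_convergence[OF sm f w lim bound]
  show "in_L2 M f" by (rule L(1))
  fix e :: real assume "0 < e"
  with L(2) obtain n where "L2_norm_sq M (\<lambda>x. f x - s n x) < e"
    by (metis (no_types, lifting) order_tendstoD(2) eventually_sequentially order_refl)
  with s show "\<exists>g. trig_approx M g \<and> L2_norm_sq M (\<lambda>x. f x - g x) < e" by blast
qed

lemma trig_approx_continuous_torus: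
  fixes h :: "complex ^ 'n \<Rightarrow> real"
  assumes h: "continuous_on UNIV h" and bdd: "\<And>z. \<bar>h z\<bar> \<le> 1"
  shows "trig_approx M (\<lambda>x. of_real (h (torus_map x)))"
proof -
  have "\<exists>p. p \<in> trig_poly \<and> (\<forall>x. cmod (of_real (h (torus_map x)) - p x) < 1 / real (Suc n))" for n
    using continuous_on_torus_approx[OF h, of "1 / real (Suc n)"] by auto
  then obtain p where p: "\<And>n. p n \<in> trig_poly"
    "\<And>n x. cmod (of_real (h (torus_map x)) - p n x) < 1 / real (Suc n)" by metis
  show ?thesis
  \<comment> \<open>The majorant 2 is the bound 1 for \<open>h\<close> plus an approximation error
    of at most 1.\<close>
  proof (rule trig_approx_dominated[where s = p and w = "\<lambda>_. 2"])
    show "trig_approx M (p n)" for n by (rule trig_approx_trig_poly[OF p(1)])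
    have "h \<in> borel_measurable borel" by (rule borel_measurable_continuous_onI[OF h])
    then show "(\<lambda>x. complex_of_real (h (torus_map x))) \<in> borel_measurable M"
      by (intro measurable_torus_map[of "\<lambda>z. complex_of_real (h z)"]) simp
    show "AE x in M. (\<lambda>n. p n x) \<longlonglongrightarrow> of_real (h (torus_map x))"
    proof (rule AE_I2)
      fix x
      have "(\<lambda>n. p n x - of_real (h (torus_map x))) \<longlonglongrightarrow> 0"
        by (rule Lim_null_comparison[OF _ LIMSEQ_Suc[OF lim_1_over_n]])
           (use p(2)[of x] in \<open>auto simp: norm_minus_commute intro!: always_eventually less_imp_le\<close>)
      then show "(\<lambda>n. p n x) \<longlonglongrightarrow> of_real (h (torus_map x))" by (simp add: LIM_zero_iff)
    qed
    show "AE x in M. cmod (p n x) \<le> 2" for n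
    proof (rule AE_I2)
      fix x
      have "cmod (p n x) \<le> cmod (of_real (h (torus_map x))) + cmod (of_real (h (torus_map x)) - p n x)"
        by (metis norm_triangle_sub norm_minus_commute)
      also have "\<dots> \<le> 1 + 1 / real (Suc n)"
        using p(2)[where n = n and x = x] bdd[of "torus_map x"] by (intro add_mono) auto
      also have "\<dots> \<le> 2" by (simp add: field_simps)
      finally show "cmod (p n x) \<le> 2" .
    qed
  qed simp
qed

lemma trig_approx_open_torus:
  fixes U :: "(complex ^ 'n) set"
  assumes "open U"
  shows "trig_approx M (\<lambda>x. indicator U (torus_map x))"
\<comment> \<open>The whole space is treated apart: \<open>infdist\<close> to the empty complement
  is 0 by convention, and the functions \<open>h n\<close> below would vanish.\<close>
proof (cases "U = UNIV")
  case True
  then show ?thesis using trig_approx_trig_poly[OF trig_poly_const[of 1]] by simp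
next
  case False
  \<comment> \<open>Continuous functions increasing to the indicator: they vanish off U, and at a
    point of U at distance r > 0 from the complement they equal 1 once n r is at least 1.\<close>
  define h where "h n z = min 1 (real n * infdist z (- U))" for n z
  show ?thesis
  proof (rule trig_approx_dominated[where s = "\<lambda>n x. of_real (h n (torus_map x))" and w = "\<lambda>_. 1"])
    have h: "\<bar>h n z\<bar> \<le> 1" for n z by (simp add: h_def infdist_nonneg)
    show "trig_approx M (\<lambda>x. complex_of_real (h n (torus_map x)))" for n
      using h by (intro trig_approx_continuous_torus) (auto simp: h_def intro!: continuous_intros)
    show "AE x in M. cmod (complex_of_real (h n (torus_map x))) \<le> 1" for n
      using h by simp
    have "U \<in> sets borel" using assms by simp
    then show "(\<lambda>x. indicator U (torus_map x) :: complex) \<in> borel_measurable M"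
      by (intro measurable_torus_map borel_measurable_indicator)
    have "(\<lambda>n. h n z) \<longlonglongrightarrow> indicator U z" for z
    proof (cases "z \<in> U")
      case True
      have "closed (- U)" "- U \<noteq> {}" using assms False by auto
      then have pos: "0 < infdist z (- U)"
        using True in_closed_iff_infdist_zero[of "- U" z] infdist_nonneg[of z "- U"] by force
      obtain N where "1 / infdist z (- U) < real N" using reals_Archimedean2 by blast
      then have N: "1 < real N * infdist z (- U)" using pos by (simp add: field_simps)
      have "h n z = 1" if "N \<le> n" for n
      proof -
        have "real N * infdist z (- U) \<le> real n * infdist z (- U)"
          using that pos by (intro mult_right_mono) auto
        with N show ?thesis by (simp add: h_def)
      qed
      then have "eventually (\<lambda>n. h n z = 1) sequentially" by (auto simp: eventually_sequentially)
      with True show ?thesis by (simp add: tendsto_eventually)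
    next
      case False
      then show ?thesis by (simp add: h_def)
    qed
    then have "(\<lambda>n. complex_of_real (h n z)) \<longlonglongrightarrow> of_real (indicator U z)" for z
      by (rule tendsto_of_real)
    then show "AE x in M. (\<lambda>n. complex_of_real (h n (torus_map x))) \<longlonglongrightarrow> indicator U (torus_map x)"
      by (simp only: of_real_indicator AE_I2)
  qed simp
qed

lemma trig_approx_borel_torus:
  fixes A :: "(complex ^ 'n) set"
  assumes "A \<in> sets borel"
  shows "trig_approx M (\<lambda>x. indicator A (torus_map x))"
proof -
  have "Int_stable (Collect open :: (complex ^ 'n) set set)" by (auto simp: Int_stable_def)
  moreover have "Collect open \<subseteq> Pow (UNIV :: (complex ^ 'n) set)" by simp
  moreover have "A \<in> sigma_sets UNIV (Collect open)" using assms by (simp add: borel_def)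
  ultimately show ?thesis
  proof (induction A rule: sigma_sets_induct_disjoint)
    case (basic A)
    then show ?case by (simp add: trig_approx_open_torus)
  next
    case empty
    show ?case using trig_approx_open_torus[of "{}"] by simp
  next
    case (compl A)
    have "(\<lambda>x. indicator (UNIV - A) (torus_map x)) = (\<lambda>x. 1 + (-1) * indicator A (torus_map x) :: complex)"
      by (auto simp: indicator_def fun_eq_iff)
    moreover have "trig_approx M \<dots>"
      by (rule trig_approx_add[OF trig_approx_trig_poly[OF trig_poly_const] trig_approx_scale[OF compl(2)]])
    ultimately show ?case by (simp only:)
  next
    case (union A)
    show ?case
    proof (rule trig_approx_dominated[where w = "\<lambda>_. 1"
          and s = "\<lambda>n x. \<Sum>i<n. indicator (A i) (torus_map x)"])
      show "trig_approx M (\<lambda>x. \<Sum>i<n. indicator (A i) (torus_map x))" for n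
        by (intro trig_approx_sum union(3)) simp
      have "(\<Union>i. A i) \<in> sets borel" using union(2) by (intro sets.countable_UN) (auto simp: borel_def)
      then show "(\<lambda>x. indicator (\<Union>i. A i) (torus_map x) :: complex) \<in> borel_measurable M"
        by (intro measurable_torus_map borel_measurable_indicator)
      \<comment> \<open>Disjointness turns the partial sums into indicators, which is what bounds
        them all by 1.\<close>
      have sum_eq: "(\<Sum>i<n. indicator (A i) z :: complex) = indicator (\<Union>i<n. A i) z" for n z
        using union(1) by (subst indicator_UN_disjoint) (auto simp: disjoint_family_on_def)
      show "AE x in M. cmod (\<Sum>i<n. indicator (A i) (torus_map x)) \<le> 1" for n
        unfolding sum_eq by (simp add: indicator_def)
      have "(\<lambda>n. indicator (\<Union>i<n. A i) z :: complex) \<longlonglongrightarrow> indicator (\<Union>i. A i) z" for z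
        by (rule LIMSEQ_indicator_UN)
      then show "AE x in M. (\<lambda>n. \<Sum>i<n. indicator (A i) (torus_map x))
          \<longlonglongrightarrow> (indicator (\<Union>i. A i) (torus_map x) :: complex)"
        unfolding sum_eq by simp
    qed simp
  qed
qed

lemma trig_approx_cong_AE:
  assumes "trig_approx M f" "g \<in> borel_measurable M" "AE x in M. f x = g x"
  shows "trig_approx M g"
proof (rule trig_approx_dominated[where s = "\<lambda>_. f" and w = "\<lambda>x. cmod (f x)"])
  show "AE x in M. (\<lambda>n. f x) \<longlonglongrightarrow> g x" using assms(3) by eventually_elim simp
qed (use assms in \<open>auto simp: trig_approx_def in_L2_def\<close>)

text \<open>Up to a null set, A is the preimage under \<open>torus_map\<close> of the Borel set of
  all z with \<open>torus_inv z\<close> in A.\<close>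

lemma trig_approx_indicator:
  assumes "A \<in> sets M"
  shows "trig_approx M (indicator A)"
proof -
  have A: "A \<in> sets borel" using assms by (simp add: sets_M)
  have "torus_inv -` A \<in> sets borel" using measurable_sets[OF torus_inv_measurable A] by simp
  from trig_approx_borel_torus[OF this] show ?thesis
  proof (rule trig_approx_cong_AE)
    show "indicator A \<in> borel_measurable M" using assms by simp
    show "AE x in M. indicator (torus_inv -` A) (torus_map x) = indicator A x"
      using AE_cube by eventually_elim (simp add: indicator_def torus_inv_torus_map)
  qed
qed

lemma trig_approx_simple_function:
  fixes s :: "real ^ 'n \<Rightarrow> complex"
  assumes "simple_function M s"
  shows "trig_approx M s"
proof (rule trig_approx_cong_AE)
  have fin: "finite (s ` space M)" and meas: "s -` {y} \<inter> space M \<in> sets M" for y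
    using assms by (auto dest: simple_functionD)
  show "trig_approx M (\<lambda>x. \<Sum>y\<in>s ` space M. y * indicator (s -` {y} \<inter> space M) x)"
    by (intro trig_approx_sum trig_approx_scale trig_approx_indicator fin meas)
  show "s \<in> borel_measurable M" using assms by (rule borel_measurable_simple_function)
  show "AE x in M. (\<Sum>y\<in>s ` space M. y * indicator (s -` {y} \<inter> space M) x) = s x"
  proof (rule AE_I2)
    fix x assume "x \<in> space M"
    have "(\<Sum>y\<in>s ` space M. y * indicator (s -` {y} \<inter> space M) x)
        = (\<Sum>y\<in>s ` space M. indicator (s -` {y} \<inter> space M) x *\<^sub>R y)"
      by (intro sum.cong) (auto simp: indicator_def)
    also have "\<dots> = s x"
      by (rule simple_function_indicator_representation_banach[OF assms \<open>x \<in> space M\<close>, symmetric])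
    finally show "(\<Sum>y\<in>s ` space M. y * indicator (s -` {y} \<inter> space M) x) = s x" .
  qed
qed

theorem trig_approx_L2:
  assumes "in_L2 M f"
  shows "trig_approx M f"
proof -
  have f: "f \<in> borel_measurable M" "integrable M (\<lambda>x. (cmod (f x))\<^sup>2)"
    using assms by (auto simp: in_L2_def)
  \<comment> \<open>The base point 0 turns the distance bound into a norm bound, giving the
    square-integrable majorant \<open>2 * cmod (f x)\<close>.\<close>
  from borel_measurable_implies_sequence_metric[OF f(1), of 0] obtain s where
    s: "\<And>n. simple_function M (s n)" "\<And>x. x \<in> space M \<Longrightarrow> (\<lambda>n. s n x) \<longlonglongrightarrow> f x"
    "\<And>n x. x \<in> space M \<Longrightarrow> cmod (s n x) \<le> 2 * cmod (f x)"
    by (auto simp: dist_norm) metis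
  show ?thesis
  proof (rule trig_approx_dominated[where s = s and w = "\<lambda>x. 2 * cmod (f x)"])
    show "integrable M (\<lambda>x. (2 * cmod (f x))\<^sup>2)" using f by (simp add: power_mult_distrib)
  qed (use s f in \<open>auto intro: trig_approx_simple_function AE_I2\<close>)
qed

end

section \<open>Fourier coefficients and Parseval's identity\<close>

context cube_measure
begin

text \<open>On a finite measure L2 is contained in L1, by t \<le> 1 + t^2, and exponentials have
  modulus 1.\<close>

lemma integrable_L2_mult_expo:
  assumes "in_L2 M f"
  shows "integrable M (\<lambda>x. f x * cnj (expo k x))"
proof (rule Bochner_Integration.integrable_bound)
  show "integrable M (\<lambda>x. 1 + (cmod (f x))\<^sup>2)" using assms by (simp add: in_L2_def)
  have "f \<in> borel_measurable M" using assms by (simp add: in_L2_def)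
  then show "(\<lambda>x. f x * cnj (expo k x)) \<in> borel_measurable M"
    by (intro borel_measurable_times measurable_borel_M[of "\<lambda>x. cnj (expo k x)"]
        measurable_compose[OF expo_measurable borel_measurable_continuous_onI] continuous_intros)
  have "t \<le> 1 + t\<^sup>2" for t :: real
    using sum_squares_bound[of t 1] by (cases "t \<le> 0") (auto simp: power2_eq_square intro: order_trans)
  then show "AE x in M. norm (f x * cnj (expo k x)) \<le> norm (1 + (cmod (f x))\<^sup>2)"
    by (intro AE_I2) (simp add: norm_mult abs_of_nonneg add_nonneg_nonneg)
qed

lemma L2_inner_diff:
  assumes "in_L2 M f" "in_L2 M g"
  shows "L2_inner M (\<lambda>x. f x - c * g x) (expo k) = L2_inner M f (expo k) - c * L2_inner M g (expo k)"
proof -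
  have "L2_inner M (\<lambda>x. f x - c * g x) (expo k)
      = (\<integral>x. f x * cnj (expo k x) - c * (g x * cnj (expo k x)) \<partial>M)"
    by (simp add: L2_inner_def algebra_simps)
  also have "\<dots> = L2_inner M f (expo k) - c * L2_inner M g (expo k)"
    using assms by (simp add: L2_inner_def integrable_L2_mult_expo)
  finally show ?thesis .
qed

text \<open>Completing the square in c. Keeping c free serves both halves of Parseval: the true
  coefficient gives Bessel's inequality, any other c measures the loss against the best
  approximation.\<close>

lemma L2_norm_sq_diff_expo:
  assumes "in_L2 M f" "measure M (space M) = 1"
  shows "L2_norm_sq M (\<lambda>x. f x - c * expo k x)
    = L2_norm_sq M f - (cmod (L2_inner M f (expo k)))\<^sup>2 + (cmod (c - L2_inner M f (expo k)))\<^sup>2"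
proof -
  have pt: "(cmod (z - c * e))\<^sup>2 = (cmod z)\<^sup>2 - 2 * Re (cnj c * (z * cnj e)) + (cmod c)\<^sup>2"
    if "cmod e = 1" for z e
  proof -
    have "(cmod (z - c * e))\<^sup>2 = (cmod z)\<^sup>2 - 2 * Re (cnj c * (z * cnj e)) + (cmod (c * e))\<^sup>2"
      unfolding cmod_power2 by (simp add: power2_eq_square algebra_simps)
    with that show ?thesis by (simp add: norm_mult)
  qed
  note int = integrable_L2_mult_expo[OF assms(1), of k]
  have int2: "integrable M (\<lambda>x. (cmod (f x))\<^sup>2)" using assms by (simp add: in_L2_def)
  have "L2_norm_sq M (\<lambda>x. f x - c * expo k x)
      = (\<integral>x. (cmod (f x))\<^sup>2 - 2 * Re (cnj c * (f x * cnj (expo k x))) + (cmod c)\<^sup>2 \<partial>M)"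
    unfolding L2_norm_sq_def by (intro Bochner_Integration.integral_cong refl pt) simp
  also have "\<dots> = L2_norm_sq M f - 2 * (\<integral>x. Re (cnj c * (f x * cnj (expo k x))) \<partial>M) + (cmod c)\<^sup>2"
  proof -
    have "integrable M (\<lambda>x. Re (cnj c * (f x * cnj (expo k x))))"
      using int by (intro integrable_Re integrable_mult_right)
    then have "has_bochner_integral M (\<lambda>x. (cmod (f x))\<^sup>2 - 2 * Re (cnj c * (f x * cnj (expo k x))) + (cmod c)\<^sup>2)
        ((\<integral>x. (cmod (f x))\<^sup>2 \<partial>M) - 2 * (\<integral>x. Re (cnj c * (f x * cnj (expo k x))) \<partial>M)
          + (\<integral>x. (cmod c)\<^sup>2 \<partial>M))"
      using int2 by (intro has_bochner_integral_add has_bochner_integral_diff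
          has_bochner_integral_mult_right has_bochner_integral_integrable) auto
    then show ?thesis
      using assms(2) by (simp only: has_bochner_integral_integral_eq L2_norm_sq_def) simp
  qed
  also have "(\<integral>x. Re (cnj c * (f x * cnj (expo k x))) \<partial>M) = Re (cnj c * L2_inner M f (expo k))"
    using int by (subst integral_Re) (auto simp: L2_inner_def)
  also have "L2_norm_sq M f - 2 * Re (cnj c * L2_inner M f (expo k)) + (cmod c)\<^sup>2
      = L2_norm_sq M f - (cmod (L2_inner M f (expo k)))\<^sup>2 + (cmod (c - L2_inner M f (expo k)))\<^sup>2"
    unfolding cmod_power2 by (simp add: power2_eq_square algebra_simps)
  finally show ?thesis .
qed

end

text \<open>Different integer frequencies can agree almost everywhere: the segment sees only one
  coordinate. K holds one representative of each class, and \<open>covers\<close> transfers the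
  density of all integer exponentials to those of K.\<close>

locale fourier_basis = cube_measure +
  fixes K :: "(real ^ 'n) set"
  assumes K_int: "K \<subseteq> int_vecs"
    and orthonormal: "\<And>k l. k \<in> K \<Longrightarrow> l \<in> K \<Longrightarrow> L2_inner M (expo k) (expo l) = (if k = l then 1 else 0)"
    and covers: "\<And>l. l \<in> int_vecs \<Longrightarrow> \<exists>k\<in>K. AE x in M. expo l x = expo k x"
begin

text \<open>The total mass is the squared norm of any exponential in K; K is nonempty because it
  represents the frequency 0.\<close>

lemma measure_space_1: "measure M (space M) = 1"
proof -
  have "0 \<in> int_vecs" by (simp add: int_vecs_def)
  then obtain k where "k \<in> K" using covers by blast
  then have "L2_inner M (expo k) (expo k) = 1" by (simp add: orthonormal)
  moreover have "expo k x * cnj (expo k x) = 1" for x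
    using complex_norm_square[of "expo k x"] by simp
  ultimately have "complex_of_real (measure M (space M)) = 1"
    by (simp add: L2_inner_def scaleR_conv_of_real)
  then show ?thesis by simp
qed

lemma partial_sum_L2: "finite F \<Longrightarrow> F \<subseteq> K \<Longrightarrow> in_L2 M (\<lambda>x. \<Sum>k\<in>F. c k * expo k x)"
  using K_int by (intro in_L2_trig_poly trig_poly_sum trig_poly.scale trig_poly.base) auto

text \<open>The second conjunct carries the induction: by orthogonality, subtracting terms from F
  leaves the other coefficients unchanged, so the next completed square is taken at the original
  coefficient of f.\<close>

lemma partial_sum_error:
  assumes f: "in_L2 M f" and F: "finite F" "F \<subseteq> K"
  shows "L2_norm_sq M (\<lambda>x. f x - (\<Sum>k\<in>F. c k * expo k x))
      = L2_norm_sq M f - (\<Sum>k\<in>F. (cmod (L2_inner M f (expo k)))\<^sup>2)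
        + (\<Sum>k\<in>F. (cmod (c k - L2_inner M f (expo k)))\<^sup>2)
    \<and> (\<forall>l\<in>K - F. L2_inner M (\<lambda>x. f x - (\<Sum>k\<in>F. c k * expo k x)) (expo l) = L2_inner M f (expo l))"
  using F
proof (induction F rule: finite_induct)
  case empty
  show ?case by simp
next
  case (insert k F)
  define g where "g x = f x - (\<Sum>k\<in>F. c k * expo k x)" for x
  have k: "k \<in> K" and F: "F \<subseteq> K" using insert by auto
  have g: "in_L2 M g" unfolding g_def by (intro in_L2_diff f partial_sum_L2 insert F)
  have split: "(\<lambda>x. f x - (\<Sum>k\<in>insert k F. c k * expo k x)) = (\<lambda>x. g x - c k * expo k x)"
    using insert.hyps by (simp add: g_def algebra_simps)
  note IH = insert.IH[OF F, folded g_def]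
  have gk: "L2_inner M g (expo k) = L2_inner M f (expo k)" using IH k insert.hyps by simp
  have "L2_inner M (\<lambda>x. g x - c k * expo k x) (expo l) = L2_inner M f (expo l)"
    if "l \<in> K - insert k F" for l
  proof -
    have "in_L2 M (expo k)" using k K_int by (intro in_L2_trig_poly trig_poly.base) auto
    then show ?thesis using that IH k by (subst L2_inner_diff[OF g]) (auto simp: orthonormal)
  qed
  then show ?case
    unfolding split L2_norm_sq_diff_expo[OF g measure_space_1] gk
    using IH insert.hyps by simp
qed

text \<open>Supplies the normal form that \<open>partial_sum_error\<close> expects: every integer
  frequency is replaced by its representative in K, and coefficients of common frequencies are
  added.\<close>

lemma trig_poly_expansion:
  assumes "p \<in> trig_poly"
  shows "\<exists>F c. finite F \<and> F \<subseteq> K \<and> (AE x in M. p x = (\<Sum>k\<in>F. c k * expo k x))"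
  using assms
proof induction
  case (base l)
  then obtain k where "k \<in> K" "AE x in M. expo l x = expo k x" using covers by blast
  then show ?case by (intro exI[of _ "{k}"] exI[of _ "\<lambda>_. 1"]) simp
next
  case (add p q)
  then obtain F c G d where F: "finite F" "F \<subseteq> K" "AE x in M. p x = (\<Sum>k\<in>F. c k * expo k x)"
    and G: "finite G" "G \<subseteq> K" "AE x in M. q x = (\<Sum>k\<in>G. d k * expo k x)" by blast
  define b where "b k = (if k \<in> F then c k else 0) + (if k \<in> G then d k else 0)" for k
  have "(\<Sum>k\<in>F \<union> G. b k * expo k x) = (\<Sum>k\<in>F. c k * expo k x) + (\<Sum>k\<in>G. d k * expo k x)" for x
  proof -
    have "(\<Sum>k\<in>F \<union> G. b k * expo k x) = (\<Sum>k\<in>F \<union> G. if k \<in> F then c k * expo k x else 0)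
        + (\<Sum>k\<in>F \<union> G. if k \<in> G then d k * expo k x else 0)"
      unfolding sum.distrib[symmetric] by (intro sum.cong) (auto simp: b_def algebra_simps)
    also have "\<dots> = (\<Sum>k\<in>F. c k * expo k x) + (\<Sum>k\<in>G. d k * expo k x)"
      using F(1) G(1) by (intro arg_cong2[of _ _ _ _ "(+)"] sum.mono_neutral_cong_right) auto
    finally show ?thesis .
  qed
  note b_sum = this
  have "AE x in M. p x + q x = (\<Sum>k\<in>F \<union> G. b k * expo k x)"
    using F(3) G(3) by eventually_elim (simp only: b_sum)
  with F G show ?case by (intro exI[of _ "F \<union> G"] exI[of _ b]) simp
next
  case (scale p a)
  then obtain F c where F: "finite F" "F \<subseteq> K" "AE x in M. p x = (\<Sum>k\<in>F. c k * expo k x)" by blast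
  then have "AE x in M. a * p x = (\<Sum>k\<in>F. (a * c k) * expo k x)"
    by (auto simp: sum_distrib_left mult.assoc)
  with F show ?case by (intro exI[of _ F] exI[of _ "\<lambda>k. a * c k"]) simp
qed

text \<open>Two uses of \<open>partial_sum_error\<close>. For the lower bound, a close trigonometric
  polynomial has error at least the norm minus a finite coefficient sum, whatever its coefficients.
  For the upper bound, the true coefficients make the last sum vanish, and the remaining error is
  nonnegative.\<close>

theorem parseval:
  assumes f: "in_L2 M f"
  shows "((\<lambda>k. (cmod (L2_inner M f (expo k)))\<^sup>2) has_sum L2_norm_sq M f) K"
  unfolding has_sum_def
proof (rule order_tendstoI)
  let ?S = "\<lambda>F. \<Sum>k\<in>F. (cmod (L2_inner M f (expo k)))\<^sup>2"
  fix a assume "a < L2_norm_sq M f"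
  with trig_approx_L2[OF f] obtain p where p: "p \<in> trig_poly"
    "L2_norm_sq M (\<lambda>x. f x - p x) < L2_norm_sq M f - a"
    unfolding trig_approx_def by (metis diff_gt_0_iff_gt)
  from trig_poly_expansion[OF p(1)] obtain F c
    where F: "finite F" "F \<subseteq> K" and pF: "AE x in M. p x = (\<Sum>k\<in>F. c k * expo k x)" by blast
  have sm: "(\<lambda>x. \<Sum>k\<in>F. c k * expo k x) \<in> borel_measurable M"
    using partial_sum_L2[OF F] by (rule in_L2_measurable)
  have "L2_norm_sq M (\<lambda>x. f x - p x) = L2_norm_sq M (\<lambda>x. f x - (\<Sum>k\<in>F. c k * expo k x))"
    unfolding L2_norm_sq_def
  proof (rule integral_cong_AE)
    show "AE x in M. (cmod (f x - p x))\<^sup>2 = (cmod (f x - (\<Sum>k\<in>F. c k * expo k x)))\<^sup>2"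
      using pF by eventually_elim simp
  qed (use in_L2_measurable[OF f] in_L2_measurable[OF in_L2_trig_poly[OF p(1)]] sm in simp_all)
  also have "\<dots> \<ge> L2_norm_sq M f - ?S F"
    using partial_sum_error[OF f F, of c] by (simp add: sum_nonneg)
  finally have aF: "a < ?S F" using p(2) by simp
  show "eventually (\<lambda>G. a < ?S G) (finite_subsets_at_top K)"
    unfolding eventually_finite_subsets_at_top
  proof (intro exI[of _ F] conjI allI impI F)
    fix G assume "finite G \<and> F \<subseteq> G \<and> G \<subseteq> K"
    then have "?S F \<le> ?S G" by (intro sum_mono2) auto
    with aF show "a < ?S G" by simp
  qed
next
  let ?S = "\<lambda>F. \<Sum>k\<in>F. (cmod (L2_inner M f (expo k)))\<^sup>2"
  fix a assume a: "L2_norm_sq M f < a"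
  show "eventually (\<lambda>G. ?S G < a) (finite_subsets_at_top K)"
  proof (rule eventually_finite_subsets_at_top_weakI)
    fix G assume "finite G" "G \<subseteq> K"
    from partial_sum_error[OF f this, of "\<lambda>k. L2_inner M f (expo k)"]
    have "0 \<le> L2_norm_sq M f - ?S G"
      using L2_norm_sq_nonneg[of M "\<lambda>x. f x - (\<Sum>k\<in>G. L2_inner M f (expo k) * expo k x)"] by simp
    with a show "?S G < a" by simp
  qed
qed

end

section \<open>Orthonormal bases for the segment and the face\<close>

abbreviation unit_interval :: "real measure" where
  "unit_interval \<equiv> restrict_space lborel {0..1}"

lemma prob_space_unit_interval: "prob_space unit_interval"
  by (rule prob_spaceI) (simp add: space_restrict_space emeasure_restrict_space)

lemma AE_unit_interval: "AE t in unit_interval. 0 \<le> t \<and> t < 1"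
proof -
  have "AE t in lborel. t \<noteq> (1::real)" by (rule AE_lborel_singleton)
  then have "AE t in unit_interval. t \<noteq> 1"
    by (subst AE_restrict_space_iff) auto
  moreover have "AE t in unit_interval. 0 \<le> t \<and> t \<le> 1"
    by (rule AE_I2) (simp add: space_restrict_space)
  ultimately show ?thesis by eventually_elim auto
qed

lemma measurable_unit_interval: "f \<in> borel_measurable borel \<Longrightarrow> f \<in> borel_measurable unit_interval"
  by (simp add: measurable_restrict_space1)

lemma integral_cis_unit_interval:
  assumes "m \<in> \<int>"
  shows "(\<integral>t. cis (2 * pi * (m * t)) \<partial>unit_interval) = (if m = 0 then 1 else 0)"
proof (cases "m = 0")
  case True
  interpret prob_space unit_interval by (rule prob_space_unit_interval)
  show ?thesis using True prob_space by (simp add: space_restrict_space)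
next
  case False
  define a where "a = \<i> * complex_of_real (2 * pi * m)"
  have "a \<noteq> 0" using False by (simp add: a_def)
  have cis_a: "cis (2 * pi * (m * t)) = exp (a * of_real t)" for t
    by (simp add: a_def cis_conv_exp mult_ac)
  have "(\<integral>t. cis (2 * pi * (m * t)) \<partial>unit_interval) = (\<integral>t. indicator {0..1} t *\<^sub>R exp (a * of_real t) \<partial>lborel)"
    by (subst integral_restrict_space) (auto simp: cis_a)
  also have "\<dots> = exp (a * of_real 1) / a - exp (a * of_real 0) / a"
  proof (rule integral_FTC_Icc)
    fix t :: real
    have "((\<lambda>z. exp (a * z) / a) has_field_derivative exp (a * of_real t)) (at (of_real t))"
      using \<open>a \<noteq> 0\<close> by (auto intro!: derivative_eq_intros)
    from has_vector_derivative_real_field[OF this]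
    show "((\<lambda>t. exp (a * of_real t) / a) has_vector_derivative exp (a * of_real t)) (at t within {0..1})"
      by simp
  qed (auto intro!: continuous_intros)
  \<comment> \<open>Integrality of m enters here: the antiderivative takes the same value at both
    ends.\<close>
  also have "exp (a * of_real 1) = 1"
    using cis_multiple_2pi[OF assms] cis_a[of 1] by simp
  finally show ?thesis using False by simp
qed

text \<open>The set {i} serves the segment and its complement the face. Complementary index sets
  make a sum of two such vectors determine its summands.\<close>

definition coord_int_vecs :: "'n set \<Rightarrow> (real ^ 'n) set" where
  "coord_int_vecs S = {k \<in> int_vecs. \<forall>j. j \<notin> S \<longrightarrow> k $ j = 0}"

lemma coord_int_vecs_inner_eq_0:
  assumes "k \<in> coord_int_vecs S" "\<And>j. j \<in> S \<Longrightarrow> x $ j = 0"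
  shows "k \<bullet> x = 0"
  unfolding inner_vec_def
proof (intro sum.neutral ballI)
  show "k $ j \<bullet> x $ j = 0" for j
    using assms by (cases "j \<in> S") (auto simp: coord_int_vecs_def)
qed

lemma countable_coord_int_vecs: "countable (coord_int_vecs S)"
proof (rule countable_subset)
  show "coord_int_vecs S \<subseteq> range (\<lambda>g :: 'a \<Rightarrow> int. \<chi> j. of_int (g j))"
  proof
    fix k :: "real ^ 'a" assume "k \<in> coord_int_vecs S"
    then have "k = (\<chi> j. of_int \<lfloor>k $ j\<rfloor>)"
      by (simp add: coord_int_vecs_def int_vecs_def vec_eq_iff)
    then show "k \<in> range (\<lambda>g :: 'a \<Rightarrow> int. \<chi> j. of_int (g j))"
      by (intro image_eqI[of _ _ "\<lambda>j. \<lfloor>k $ j\<rfloor>"]) auto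
  qed
qed simp

text \<open>Ensures that both bases can be enumerated bijectively by all natural numbers, as the
  pairing requires.\<close>

lemma infinite_coord_int_vecs:
  assumes "j \<in> S"
  shows "infinite (coord_int_vecs S)"
proof
  assume "finite (coord_int_vecs S)"
  moreover have "range (\<lambda>n::nat. real n *\<^sub>R axis j 1 :: real ^ 'a) \<subseteq> coord_int_vecs S"
    using assms by (auto simp: coord_int_vecs_def int_vecs_def axis_def)
  moreover have "inj (\<lambda>n::nat. real n *\<^sub>R axis j 1 :: real ^ 'a)"
    by (auto simp: inj_def vec_eq_iff axis_def)
  ultimately show False using finite_subset range_inj_infinite by blast
qed

lemma expo_mult_cnj: "expo k x * cnj (expo l x) = expo (k - l) x"
  by (simp add: expo_def cis_cnj cis_mult inner_diff_left algebra_simps)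

text \<open>Products of exponentials with conjugates are exponentials of differences, so integrals
  of single exponentials settle orthonormality. The representative of an integer frequency is found
  by zeroing the coordinates outside S.\<close>

lemma fourier_basis_coord_int_vecs:
  assumes "cube_measure M"
    and supp: "AE x in M. \<forall>j. j \<notin> S \<longrightarrow> x $ j = 0"
    and int: "\<And>m. m \<in> int_vecs \<Longrightarrow> (\<integral>x. expo m x \<partial>M) = (if \<forall>j\<in>S. m $ j = 0 then 1 else 0)"
  shows "fourier_basis M (coord_int_vecs S)"
proof -
  interpret cube_measure M by fact
  show ?thesis
  proof
    show "coord_int_vecs S \<subseteq> int_vecs" by (auto simp: coord_int_vecs_def)
  next
    fix k l assume kl: "k \<in> coord_int_vecs S" "l \<in> coord_int_vecs S"
    then have "(\<forall>j\<in>S. (k - l) $ j = 0) \<longleftrightarrow> k = l"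
      by (auto simp: coord_int_vecs_def vec_eq_iff)
    moreover have "k - l \<in> int_vecs" using kl by (simp add: coord_int_vecs_def int_vecs_def)
    ultimately show "L2_inner M (expo k) (expo l) = (if k = l then 1 else 0)"
      by (simp add: L2_inner_def expo_mult_cnj int)
  next
    fix l :: "real ^ 'a" assume l: "l \<in> int_vecs"
    define k :: "real ^ 'a" where "k = (\<chi> j. if j \<in> S then l $ j else 0)"
    have "k \<in> coord_int_vecs S" using l by (simp add: k_def coord_int_vecs_def int_vecs_def)
    moreover have "AE x in M. expo l x = expo k x"
      using supp
    proof eventually_elim
      case (elim x)
      then have "l \<bullet> x = k \<bullet> x" by (auto simp: inner_vec_def k_def intro!: sum.cong)
      then show ?case by (simp add: expo_def)
    qed
    ultimately show "\<exists>k\<in>coord_int_vecs S. AE x in M. expo l x = expo k x" by blast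
  qed
qed

text \<open>Transfer to the image measure requires the condition to cut out a Borel set; here it is
  a finite intersection of coordinate preimages.\<close>

lemma AE_distr_vec:
  fixes T :: "'a \<Rightarrow> real ^ 'n"
  assumes T: "T \<in> borel_measurable P" and A: "\<And>j. A j \<in> sets borel"
    and AE: "AE y in P. \<forall>j. T y $ j \<in> A j"
  shows "AE x in distr P borel T. \<forall>j. x $ j \<in> A j"
proof (subst AE_distr_iff[OF T])
  have "(\<lambda>x::real ^ 'n. x $ j) \<in> borel_measurable borel" for j
    by (intro borel_measurable_continuous_onI continuous_intros)
  from measurable_sets[OF this A] have "(\<lambda>x::real ^ 'n. x $ j) -` A j \<in> sets borel" for j
    by simp
  then have "(\<Inter>j. (\<lambda>x::real ^ 'n. x $ j) -` A j) \<in> sets borel"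
    by (intro sets.finite_INT) auto
  moreover have "(\<Inter>j. (\<lambda>x::real ^ 'n. x $ j) -` A j) = {x. \<forall>j. x $ j \<in> A j}" by auto
  ultimately show "{x \<in> space borel. \<forall>j. x $ j \<in> A j} \<in> sets borel" by simp
qed (rule AE)

lemma segment_map_measurable:
  "(\<lambda>t. \<chi> j. if j = i then t else 0) \<in> borel_measurable unit_interval"
proof -
  have "(\<lambda>t. \<chi> j. if j = i then t else 0) = (\<lambda>t::real. t *\<^sub>R axis i 1)"
    by (auto simp: fun_eq_iff vec_eq_iff axis_def)
  then show ?thesis
    by (auto intro!: measurable_unit_interval borel_measurable_continuous_onI continuous_intros)
qed

lemma AE_segment: "AE x in segment_measure i. \<forall>j. x $ j \<in> (if j = i then {0..<1} else {0})"
  unfolding segment_measure_def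
  by (rule AE_distr_vec[OF segment_map_measurable]) (use AE_unit_interval in auto)

lemma fourier_basis_segment: "fourier_basis (segment_measure i) (coord_int_vecs {i})"
proof (rule fourier_basis_coord_int_vecs)
  interpret prob_space unit_interval by (rule prob_space_unit_interval)
  note meas = segment_map_measurable[of i]
  note AE = AE_segment[of i]
  have "prob_space (segment_measure i)"
    unfolding segment_measure_def by (rule prob_space_distr[OF meas])
  then interpret seg: prob_space "segment_measure i" .
  show "cube_measure (segment_measure i)"
  proof
    show "AE x in segment_measure i. \<forall>j. 0 \<le> x $ j \<and> x $ j < 1"
      using AE by eventually_elim (auto split: if_splits)
  qed (simp add: segment_measure_def)
  show "AE x in segment_measure i. \<forall>j. j \<notin> {i} \<longrightarrow> x $ j = 0"
    using AE by eventually_elim (auto split: if_splits)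
  fix m :: "real ^ 'a" assume m: "m \<in> int_vecs"
  have "expo m (\<chi> j. if j = i then t else 0) = cis (2 * pi * (m $ i * t))" for t
    by (simp add: expo_def inner_vec_def if_distrib cong: if_cong)
  then have "(\<integral>x. expo m x \<partial>segment_measure i) = (\<integral>t. cis (2 * pi * (m $ i * t)) \<partial>unit_interval)"
    unfolding segment_measure_def by (subst integral_distr[OF meas expo_measurable]) simp
  also have "\<dots> = (if m $ i = 0 then 1 else 0)"
    using m by (intro integral_cis_unit_interval) (simp add: int_vecs_def)
  finally show "(\<integral>x. expo m x \<partial>segment_measure i) = (if \<forall>j\<in>{i}. m $ j = 0 then 1 else 0)"
    by simp
qed

lemma face_map_measurable:
  "(\<lambda>y. \<chi> j. if j = i then 0 else y j) \<in> borel_measurable (PiM (UNIV - {i}) (\<lambda>_. unit_interval))"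
proof (rule borel_measurable_euclidean_space[THEN iffD2], intro ballI)
  fix b :: "real ^ 'a" assume "b \<in> Basis"
  then obtain k where b: "b = axis k 1" by (auto simp: Basis_vec_def)
  have "(\<lambda>y. y k) \<in> borel_measurable (PiM (UNIV - {i}) (\<lambda>_. unit_interval))" if "k \<noteq> i"
    using that measurable_compose[OF measurable_component_singleton[of k "UNIV - {i}" "\<lambda>_. unit_interval"]
        measurable_unit_interval[of "\<lambda>t. t"]] by simp
  then show "(\<lambda>y. (\<chi> j. if j = i then 0 else y j) \<bullet> b)
      \<in> borel_measurable (PiM (UNIV - {i}) (\<lambda>_. unit_interval))"
    by (cases "k = i") (simp_all add: b inner_axis)
qed

lemma cis_sum: "finite A \<Longrightarrow> cis (\<Sum>j\<in>A. f j) = (\<Prod>j\<in>A. cis (f j))"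
  by (induction A rule: finite_induct) (simp_all flip: cis_mult)

lemma product_prob_space_unit_interval: "product_prob_space (\<lambda>_. unit_interval)"
  by (simp add: product_prob_space_def product_prob_space_axioms_def product_sigma_finite_def
      prob_space_unit_interval prob_space_imp_sigma_finite)

lemma prob_space_face: "prob_space (face_measure i)"
  unfolding face_measure_def
  by (rule prob_space.prob_space_distr[OF prob_space_PiM[OF prob_space_unit_interval] face_map_measurable])

lemma AE_face: "AE x in face_measure i. \<forall>j. x $ j \<in> (if j = i then {0} else {0..<1})"
  unfolding face_measure_def
proof (rule AE_distr_vec[OF face_map_measurable])
  have "AE y in PiM (UNIV - {i}) (\<lambda>_. unit_interval). \<forall>j\<in>UNIV - {i}. 0 \<le> y j \<and> y j < 1"
    by (intro AE_finite_allI AE_PiM_component[OF prob_space_unit_interval _ AE_unit_interval]) auto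
  then show "AE y in PiM (UNIV - {i}) (\<lambda>_. unit_interval).
      \<forall>j. (\<chi> j. if j = i then 0 else y j) $ j \<in> (if j = i then {0} else {0..<1})"
    by eventually_elim simp
qed auto

lemma fourier_basis_face: "fourier_basis (face_measure i) (coord_int_vecs (- {i}))"
proof (rule fourier_basis_coord_int_vecs)
  show "cube_measure (face_measure i)"
  proof (intro cube_measure.intro cube_measure_axioms.intro)
    show "finite_measure (face_measure i)"
      using prob_space_face by (rule prob_space.finite_measure)
    show "AE x in face_measure i. \<forall>j. 0 \<le> x $ j \<and> x $ j < 1"
      using AE_face[of i]
    proof eventually_elim
      case (elim x)
      show ?case
      proof
        fix j show "0 \<le> x $ j \<and> x $ j < 1" using spec[OF elim, of j] by (simp split: if_splits)
      qed
    qed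
  qed (simp add: face_measure_def)
  show "AE x in face_measure i. \<forall>j. j \<notin> - {i} \<longrightarrow> x $ j = 0"
    using AE_face[of i] by eventually_elim (metis (mono_tags) ComplI singletonD singletonI)
  fix m :: "real ^ 'a" assume m: "m \<in> int_vecs"
  interpret U: prob_space unit_interval by (rule prob_space_unit_interval)
  interpret P: product_prob_space "\<lambda>_::'a. unit_interval"
    by (rule product_prob_space_unit_interval)
  note meas = face_map_measurable[of i]
  \<comment> \<open>The exponential is a product of functions of one coordinate each, so its
    integral over the product measure factors into one-dimensional integrals.\<close>
  have expo: "expo m (\<chi> j. if j = i then 0 else y j) = (\<Prod>j\<in>UNIV - {i}. cis (2 * pi * (m $ j * y j)))" for y
  proof -
    have "m \<bullet> (\<chi> j. if j = i then 0 else y j) = (\<Sum>j\<in>UNIV - {i}. m $ j * y j)"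
      unfolding inner_vec_def by (rule sum.mono_neutral_cong_right) auto
    then show ?thesis by (simp add: expo_def sum_distrib_left flip: cis_sum)
  qed
  have "integrable unit_interval (\<lambda>t. cis (2 * pi * (c * t)))" for c
  proof (rule U.integrable_const_bound[of _ 1])
    show "(\<lambda>t. cis (2 * pi * (c * t))) \<in> borel_measurable unit_interval"
      by (intro measurable_unit_interval borel_measurable_continuous_onI continuous_intros)
  qed simp
  then have "(\<integral>x. expo m x \<partial>face_measure i)
      = (\<Prod>j\<in>UNIV - {i}. \<integral>t. cis (2 * pi * (m $ j * t)) \<partial>unit_interval)"
    unfolding face_measure_def
    by (subst integral_distr[OF meas expo_measurable], unfold expo) (intro P.product_integral_prod; simp)
  also have "\<dots> = (\<Prod>j\<in>UNIV - {i}. if m $ j = 0 then 1 else 0)"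
    using m by (intro prod.cong refl integral_cis_unit_interval) (simp add: int_vecs_def)
  also have "\<dots> = (if \<forall>j\<in>- {i}. m $ j = 0 then 1 else 0)"
    by (auto simp: Compl_eq_Diff_UNIV intro!: prod.neutral)
  finally show "(\<integral>x. expo m x \<partial>face_measure i) = (if \<forall>j\<in>- {i}. m $ j = 0 then 1 else 0)" .
qed

section \<open>Integration against a sum of two measures\<close>

lemma sets_measure_sum [simp]: "sets (measure_sum M N) = sets M"
  by (simp add: measure_sum_def sets.sigma_sets_eq)

lemma space_measure_sum [simp]: "space (measure_sum M N) = space M"
  by (simp add: measure_sum_def)

text \<open>\<open>measure_of\<close> returns the intended values only after countable additivity is
  proved; its default is the zero measure.\<close>

lemma emeasure_measure_sum:
  assumes "sets N = sets M" "A \<in> sets M"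
  shows "emeasure (measure_sum M N) A = emeasure M A + emeasure N A"
  unfolding measure_sum_def
proof (rule emeasure_measure_of_sigma)
  show "countably_additive (sets M) (\<lambda>A. emeasure M A + emeasure N A)"
  proof (rule countably_additiveI)
    fix A :: "nat \<Rightarrow> _" assume A: "range A \<subseteq> sets M" "disjoint_family A"
    then have "(\<Sum>i. emeasure M (A i) + emeasure N (A i)) = (\<Sum>i. emeasure M (A i)) + (\<Sum>i. emeasure N (A i))"
      by (intro suminf_add[symmetric]) simp_all
    also have "\<dots> = emeasure M (\<Union>i. A i) + emeasure N (\<Union>i. A i)"
      using A assms(1) by (simp add: suminf_emeasure)
    finally show "(\<Sum>i. emeasure M (A i) + emeasure N (A i)) = emeasure M (\<Union>i. A i) + emeasure N (\<Union>i. A i)" .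
  qed
qed (use assms in \<open>auto simp: positive_def sets.sigma_algebra_axioms\<close>)

lemma nn_integral_measure_sum:
  assumes sets: "sets N = sets M" and f: "f \<in> borel_measurable M"
  shows "(\<integral>\<^sup>+x. f x \<partial>measure_sum M N) = (\<integral>\<^sup>+x. f x \<partial>M) + (\<integral>\<^sup>+x. f x \<partial>N)"
proof -
  have N: "borel_measurable N = borel_measurable M" by (rule measurable_cong_sets[OF sets refl])
  have MN: "borel_measurable (measure_sum M N) = borel_measurable M" by (rule measurable_cong_sets) simp_all
  have space: "space N = space M" by (rule sets_eq_imp_space_eq[OF sets])
  show ?thesis using f
  proof (induction rule: borel_measurable_induct)
    case (cong f g)
    then show ?case by (simp add: space cong: nn_integral_cong_simp)
  next
    case (set A)
    then show ?case by (simp add: sets emeasure_measure_sum)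
  next
    case (mult u c)
    then show ?case by (simp add: N MN nn_integral_cmult distrib_left)
  next
    case (add u v)
    then show ?case by (simp add: N MN nn_integral_add add_ac)
  next
    case (seq U)
    have mono: "incseq (\<lambda>i. \<integral>\<^sup>+x. U i x \<partial>L)" for L
      using seq(3) by (auto simp: incseq_def le_fun_def intro!: nn_integral_mono)
    have lim: "(\<integral>\<^sup>+x. (SUP i. U i x) \<partial>L) = (SUP i. \<integral>\<^sup>+x. U i x \<partial>L)"
      if "(borel_measurable L :: (_ \<Rightarrow> ennreal) set) = borel_measurable M" for L
      using seq(3) by (rule nn_integral_monotone_convergence_SUP) (subst that, rule seq(1))
    have "(SUP i. U i) = (\<lambda>x. SUP i. U i x)" by (simp add: fun_eq_iff image_image)
    then show ?case
      using lim[OF refl] lim[OF N] lim[OF MN] seq(4)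
      by (simp add: seq.IH ennreal_SUP_add[OF mono mono])
  qed
qed

lemma integrable_measure_sum:
  fixes f :: "'a \<Rightarrow> 'b::{banach, second_countable_topology}"
  assumes sets: "sets N = sets M"
  shows "integrable (measure_sum M N) f \<longleftrightarrow> integrable M f \<and> integrable N f"
proof -
  have N: "borel_measurable N = (borel_measurable M :: ('a \<Rightarrow> 'b) set)" by (rule measurable_cong_sets[OF sets refl])
  have MN: "borel_measurable (measure_sum M N) = (borel_measurable M :: ('a \<Rightarrow> 'b) set)" by (rule measurable_cong_sets) simp_all
  show ?thesis
    using nn_integral_measure_sum[OF sets, of "\<lambda>x. ennreal (norm (f x))"]
    by (auto simp: integrable_iff_bounded N MN)
qed

lemma integral_measure_sum:
  fixes f :: "'a \<Rightarrow> 'b::{banach, second_countable_topology}"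
  assumes sets: "sets N = sets M" and f: "integrable (measure_sum M N) f"
  shows "(\<integral>x. f x \<partial>measure_sum M N) = (\<integral>x. f x \<partial>M) + (\<integral>x. f x \<partial>N)"
  using f
proof (induction rule: integrable_induct)
  case (base A c)
  have space: "space N = space M" by (rule sets_eq_imp_space_eq[OF sets])
  have A: "A \<in> sets M" using base by simp
  then have "A \<subseteq> space M" by (rule sets.sets_into_space)
  moreover have "measure (measure_sum M N) A = measure M A + measure N A"
    using base(2) by (simp add: measure_def emeasure_measure_sum[OF sets A] enn2real_plus)
  ultimately show ?case using A base
    by (simp add: sets space emeasure_measure_sum[OF sets A] Int_absorb2 scaleR_left_distrib)
next
  case (add f g)
  then show ?case by (simp add: integrable_measure_sum[OF sets])
next
  case (lim f s)
  note int = integrable_measure_sum[OF sets]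
  have space: "space N = space M" by (rule sets_eq_imp_space_eq[OF sets])
  \<comment> \<open>Stated for an arbitrary L so that it serves M, N and their sum; uniqueness of
    limits then gives additivity for f.\<close>
  have conv: "(\<lambda>i. \<integral>x. s i x \<partial>L) \<longlonglongrightarrow> (\<integral>x. f x \<partial>L)"
    if "integrable L f" "\<And>i. integrable L (s i)" "space L = space M" for L
  proof (rule integral_dominated_convergence[where w = "\<lambda>x. 2 * norm (f x)"])
    show "integrable L (\<lambda>x. 2 * norm (f x))" using that by simp
  qed (use that lim in \<open>auto intro: AE_I2\<close>)
  have "(\<lambda>i. \<integral>x. s i x \<partial>measure_sum M N) \<longlonglongrightarrow> (\<integral>x. f x \<partial>measure_sum M N)"
    using lim by (intro conv) simp_all
  moreover have "(\<lambda>i. \<integral>x. s i x \<partial>measure_sum M N) \<longlonglongrightarrow> (\<integral>x. f x \<partial>M) + (\<integral>x. f x \<partial>N)"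
    unfolding lim.IH using lim by (intro tendsto_add conv) (simp_all add: int space)
  ultimately show ?case by (rule LIMSEQ_unique)
qed

section \<open>Paired sums of squares and the frame inequality\<close>

lemma suminf_div:
  fixes h :: "nat \<Rightarrow> ennreal"
  assumes "0 < d"
  shows "(\<Sum>n. h (n div d)) = of_nat d * (\<Sum>n. h n)"
proof -
  have "(\<lambda>n. h (n div d)) sums (\<Sum>n. h (n div d))" by (intro summable_sums) simp
  from sums_group[OF this assms]
  have "(\<lambda>n. \<Sum>m = n * d..<n * d + d. h (m div d)) sums (\<Sum>n. h (n div d))" .
  moreover have "(\<Sum>m = n * d..<n * d + d. h (m div d)) = of_nat d * h n" for n
  proof -
    have "m div d = n" if "m \<in> {n * d..<n * d + d}" for m
      using that assms by (intro div_nat_eqI) (auto simp: mult.commute)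
    then show ?thesis by simp
  qed
  ultimately have "(\<lambda>n. of_nat d * h n) sums (\<Sum>n. h (n div d))" by simp
  then show ?thesis by (simp add: sums_iff)
qed

text \<open>Kept additive, without isolating S, because subtraction of extended nonnegative reals
  truncates. In the second bound the 8 is 2 from the parallelogram-type estimate times the
  multiplicity 4.\<close>

lemma repeated_sum_le:
  fixes a b :: "nat \<Rightarrow> complex"
  defines "P \<equiv> (\<Sum>n. ennreal ((cmod (a n))\<^sup>2))" and "Q \<equiv> (\<Sum>n. ennreal ((cmod (b n))\<^sup>2))"
    and "S \<equiv> (\<Sum>n. ennreal ((cmod (a (n div 4) + b n))\<^sup>2))"
  shows "4 * P \<le> 2 * S + 2 * Q" and "S \<le> 8 * P + 2 * Q"
proof -
  have 4: "(\<Sum>n. ennreal ((cmod (a (n div 4)))\<^sup>2)) = 4 * P"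
    unfolding P_def using suminf_div[of 4 "\<lambda>n. ennreal ((cmod (a n))\<^sup>2)"]
    by (simp only: of_nat_numeral zero_less_numeral)
  have split: "ennreal ((cmod x)\<^sup>2) \<le> 2 * ennreal ((cmod y)\<^sup>2) + 2 * ennreal ((cmod z)\<^sup>2)"
    if "(cmod x)\<^sup>2 \<le> 2 * (cmod y)\<^sup>2 + 2 * (cmod z)\<^sup>2" for x y z
  proof -
    have "ennreal ((cmod x)\<^sup>2) \<le> ennreal (2 * (cmod y)\<^sup>2 + 2 * (cmod z)\<^sup>2)"
      using that by (rule ennreal_leI)
    also have "\<dots> = 2 * ennreal ((cmod y)\<^sup>2) + 2 * ennreal ((cmod z)\<^sup>2)"
      by (subst ennreal_plus) (simp_all add: ennreal_mult')
    finally show ?thesis .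
  qed
  have sum2: "(\<Sum>n. 2 * f n + 2 * g n) = 2 * (\<Sum>n. f n) + 2 * (\<Sum>n. g n)" for f g :: "nat \<Rightarrow> ennreal"
    by (simp add: suminf_add[symmetric] ennreal_suminf_cmult)
  have "(\<Sum>n. ennreal ((cmod (a (n div 4)))\<^sup>2))
      \<le> (\<Sum>n. 2 * ennreal ((cmod (a (n div 4) + b n))\<^sup>2) + 2 * ennreal ((cmod (b n))\<^sup>2))"
  proof (intro suminf_le split allI)
    show "(cmod (a (n div 4)))\<^sup>2 \<le> 2 * (cmod (a (n div 4) + b n))\<^sup>2 + 2 * (cmod (b n))\<^sup>2" for n
      using norm_diff_sq_le[of "a (n div 4) + b n" "b n"] by simp
  qed simp_all
  then show "4 * P \<le> 2 * S + 2 * Q" unfolding 4 sum2 S_def Q_def .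
  have "S \<le> (\<Sum>n. 2 * ennreal ((cmod (a (n div 4)))\<^sup>2) + 2 * ennreal ((cmod (b n))\<^sup>2))"
    unfolding S_def by (intro suminf_le split allI norm_add_sq_le) simp_all
  also have "\<dots> = 2 * (4 * P) + 2 * Q" unfolding sum2 4 Q_def ..
  also have "\<dots> = 8 * P + 2 * Q" by (simp flip: mult.assoc)
  finally show "S \<le> 8 * P + 2 * Q" .
qed

text \<open>A frame is indexed by a set, which counts each frequency once; injectivity is what
  permits summing over indices instead.\<close>

lemma infsum_range_ennreal:
  fixes g :: "'a \<Rightarrow> ennreal"
  assumes "inj h"
  shows "infsum g (range h) = (\<Sum>n::nat. g (h n))"
proof -
  have "((\<lambda>n. g (h n)) has_sum infsum (\<lambda>n. g (h n)) UNIV) UNIV"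
    by (intro has_sum_infsum nonneg_summable_on_complete) simp
  then show ?thesis
    using infsum_reindex[OF assms, of g] by (simp add: has_sum_imp_sums sums_unique o_def)
qed

lemma (in fourier_basis) parseval_enumeration:
  assumes "in_L2 M f" "bij_betw u (UNIV :: nat set) K"
  shows "(\<Sum>n. ennreal ((cmod (L2_inner M f (expo (u n))))\<^sup>2)) = ennreal (L2_norm_sq M f)"
proof -
  have "((\<lambda>n. (cmod (L2_inner M f (expo (u n))))\<^sup>2) has_sum L2_norm_sq M f) UNIV"
    by (rule has_sum_reindex_bij_betw[OF assms(2), THEN iffD2, OF parseval[OF assms(1)]])
  then have "(\<lambda>n. (cmod (L2_inner M f (expo (u n))))\<^sup>2) sums L2_norm_sq M f" by (rule has_sum_imp_sums)
  then show ?thesis by (rule suminf_ennreal_eq[rotated]) simp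
qed

lemma (in fourier_basis) L2_inner_shift:
  assumes "AE x in M. expo l x = expo k x" "in_L2 M f"
  shows "L2_inner M f (expo l) = L2_inner M f (expo k)"
  unfolding L2_inner_def
proof (rule integral_cong_AE)
  show "AE x in M. f x * cnj (expo l x) = f x * cnj (expo k x)"
    using assms(1) by eventually_elim simp
qed (use integrable_L2_mult_expo[OF assms(2)] in \<open>auto dest: borel_measurable_integrable\<close>)

text \<open>Stated for complementary sets of coordinates, which makes the segment and the face play
  symmetric roles. The conditions on S make both frequency sets infinite.\<close>

theorem admits_fourier_frame_measure_sum:
  fixes M N :: "(real ^ 'n) measure" and S :: "'n set"
  assumes M: "fourier_basis M (coord_int_vecs S)" and N: "fourier_basis N (coord_int_vecs (- S))"
    and suppM: "AE x in M. \<forall>j. j \<notin> S \<longrightarrow> x $ j = 0"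
    and suppN: "AE x in N. \<forall>j. j \<in> S \<longrightarrow> x $ j = 0"
    and S: "S \<noteq> {}" "S \<noteq> UNIV"
  shows "admits_fourier_frame (measure_sum M N)"
proof -
  interpret M: fourier_basis M "coord_int_vecs S" by (rule M)
  interpret N: fourier_basis N "coord_int_vecs (- S)" by (rule N)
  have sets: "sets N = sets M" by (simp add: M.sets_M N.sets_M)
  define u :: "nat \<Rightarrow> real ^ 'n" where "u = from_nat_into (coord_int_vecs S)"
  define v :: "nat \<Rightarrow> real ^ 'n" where "v = from_nat_into (coord_int_vecs (- S))"
  have u: "bij_betw u UNIV (coord_int_vecs S)"
    unfolding u_def using S(1) infinite_coord_int_vecs[of _ S]
    by (intro bij_betw_from_nat_into countable_coord_int_vecs) blast
  have v: "bij_betw v UNIV (coord_int_vecs (- S))"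
    unfolding v_def using S(2) infinite_coord_int_vecs[of _ "- S"]
    by (intro bij_betw_from_nat_into countable_coord_int_vecs) blast
  have u_in: "u n \<in> coord_int_vecs S" and v_in: "v n \<in> coord_int_vecs (- S)" for n
    using u v by (auto simp: bij_betw_def)
  \<comment> \<open>Coordinates in S recover u and the others recover v. Thus \<open>h1\<close> is
    injective because v is, although \<open>u (n div 4)\<close> repeats; likewise
    \<open>h2\<close>.\<close>
  have uv_eq: "u m = u m' \<and> v n = v n'" if "u m + v n = u m' + v n'" for m n m' n'
  proof -
    have "u m $ j = u m' $ j \<and> v n $ j = v n' $ j" for j
      using arg_cong[OF that, of "\<lambda>x. x $ j"] u_in[of m] u_in[of m'] v_in[of n] v_in[of n']
      by (cases "j \<in> S") (auto simp: coord_int_vecs_def)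
    then show ?thesis by (simp add: vec_eq_iff)
  qed
  define h1 where "h1 n = u (n div 4) + v n" for n
  define h2 where "h2 n = v (n div 4) + u n" for n
  have inj1: "inj h1"
    using v uv_eq by (auto simp: h1_def inj_def bij_betw_def)
  have inj2: "inj h2"
    using u uv_eq by (auto simp: h2_def inj_def bij_betw_def add.commute)
  \<comment> \<open>With p and q the squared norms of f on the pieces, the two families sum to s1
    \<ge> 2p - q and s2 \<ge> 2q - p, so s1 + s2 \<ge> p + q. The union is bounded below by each of
    s1 and s2, hence by their mean: this gives 1/2. The 10 is 8 + 2 from adding the upper
    bounds.\<close>
  have frame: "ennreal (1/2) * ennreal (L2_norm_sq (measure_sum M N) f)
        \<le> (\<Sum>\<^sub>\<infinity>lam\<in>range h1 \<union> range h2. ennreal ((cmod (L2_inner (measure_sum M N) f (expo lam)))\<^sup>2))"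
    and frame': "(\<Sum>\<^sub>\<infinity>lam\<in>range h1 \<union> range h2. ennreal ((cmod (L2_inner (measure_sum M N) f (expo lam)))\<^sup>2))
        \<le> ennreal 10 * ennreal (L2_norm_sq (measure_sum M N) f)"
    if f: "in_L2 (measure_sum M N) f" for f
  proof -
    have "f \<in> borel_measurable M" "f \<in> borel_measurable N"
      using f measurable_cong_sets[OF sets refl, of borel]
        measurable_cong_sets[OF sets_measure_sum[of M N] refl, of borel]
      by (auto simp: in_L2_def)
    then have fM: "in_L2 M f" and fN: "in_L2 N f"
      using f by (auto simp: in_L2_def integrable_measure_sum[OF sets])
    define p where "p = L2_norm_sq M f"
    define q where "q = L2_norm_sq N f"
    have pq: "0 \<le> p" "0 \<le> q" by (simp_all add: p_def q_def)
    have norm: "L2_norm_sq (measure_sum M N) f = p + q"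
      using f by (simp add: p_def q_def L2_norm_sq_def in_L2_def integral_measure_sum[OF sets])
    define a where "a n = L2_inner M f (expo (u n))" for n
    define b where "b n = L2_inner N f (expo (v n))" for n
    have inner: "L2_inner (measure_sum M N) f (expo (u m + v n)) = a m + b n" for m n
    proof -
      have "AE x in M. expo (u m + v n) x = expo (u m) x"
        using suppM
      proof eventually_elim
        case (elim x)
        then have "v n \<bullet> x = 0" by (intro coord_int_vecs_inner_eq_0[OF v_in]) simp
        then show ?case by (simp add: expo_def inner_left_distrib)
      qed
      moreover have "AE x in N. expo (u m + v n) x = expo (v n) x"
        using suppN
      proof eventually_elim
        case (elim x)
        then have "u m \<bullet> x = 0" by (intro coord_int_vecs_inner_eq_0[OF u_in]) simp
        then show ?case by (simp add: expo_def inner_left_distrib)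
      qed
      moreover have "L2_inner (measure_sum M N) f (expo (u m + v n))
          = L2_inner M f (expo (u m + v n)) + L2_inner N f (expo (u m + v n))"
        unfolding L2_inner_def
        by (intro integral_measure_sum sets)
           (simp add: integrable_measure_sum[OF sets] M.integrable_L2_mult_expo N.integrable_L2_mult_expo fM fN)
      ultimately show ?thesis
        using M.L2_inner_shift[OF _ fM] N.L2_inner_shift[OF _ fN] by (simp add: a_def b_def)
    qed
    define \<phi> where "\<phi> lam = ennreal ((cmod (L2_inner (measure_sum M N) f (expo lam)))\<^sup>2)" for lam
    have P: "(\<Sum>n. ennreal ((cmod (a n))\<^sup>2)) = ennreal p"
      unfolding a_def p_def by (rule M.parseval_enumeration[OF fM u])
    have Q: "(\<Sum>n. ennreal ((cmod (b n))\<^sup>2)) = ennreal q"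
      unfolding b_def q_def by (rule N.parseval_enumeration[OF fN v])
    have S1: "infsum \<phi> (range h1) = (\<Sum>n. ennreal ((cmod (a (n div 4) + b n))\<^sup>2))"
      by (simp only: infsum_range_ennreal[OF inj1] \<phi>_def h1_def inner)
    have S2: "infsum \<phi> (range h2) = (\<Sum>n. ennreal ((cmod (b (n div 4) + a n))\<^sup>2))"
      unfolding infsum_range_ennreal[OF inj2] \<phi>_def h2_def
      by (subst add.commute[of "v _"], simp only: inner add.commute[of "a _"])
    have summable: "\<phi> summable_on X" for X
      by (rule nonneg_summable_on_complete) simp
    \<comment> \<open>The ranges share the frequency \<open>u 0 + v 0\<close>, so the sum over the
      union is only compared with the two sums, not equated with their total.\<close>
    have T1: "infsum \<phi> (range h1) \<le> infsum \<phi> (range h1 \<union> range h2)"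
      and T2: "infsum \<phi> (range h2) \<le> infsum \<phi> (range h1 \<union> range h2)"
      by (rule infsum_mono_neutral[OF summable summable]; auto)+
    have "infsum \<phi> (range h1 \<union> (range h2 - range h1)) = infsum \<phi> (range h1) + infsum \<phi> (range h2 - range h1)"
      by (rule infsum_Un_disjoint[OF summable summable]) auto
    also have "\<dots> \<le> infsum \<phi> (range h1) + infsum \<phi> (range h2)"
      by (intro add_left_mono infsum_mono_neutral[OF summable summable]) auto
    finally have T: "infsum \<phi> (range h1 \<union> range h2) \<le> infsum \<phi> (range h1) + infsum \<phi> (range h2)"
      by simp
    note bounds = repeated_sum_le[of a b, folded S1, unfolded P Q]
      repeated_sum_le[of b a, folded S2, unfolded P Q]
    have fin: "8 * ennreal x + 2 * ennreal y = ennreal (8 * x + 2 * y)"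
      "4 * ennreal x = ennreal (4 * x)" "2 * ennreal x = ennreal (2 * x)"
      if "0 \<le> x" "0 \<le> y" for x y
      using that by (simp_all add: ennreal_mult')
    \<comment> \<open>The upper bounds make all three sums finite, so the inequalities can move to
      the reals, where terms may be subtracted.\<close>
    obtain s1 where s1: "infsum \<phi> (range h1) = ennreal s1" "0 \<le> s1"
      using bounds(2) fin(1)[OF pq] by (cases "infsum \<phi> (range h1)") (auto simp: top_unique)
    obtain s2 where s2: "infsum \<phi> (range h2) = ennreal s2" "0 \<le> s2"
      using bounds(4) fin(1)[OF pq(2,1)] by (cases "infsum \<phi> (range h2)") (auto simp: top_unique)
    obtain t where t: "infsum \<phi> (range h1 \<union> range h2) = ennreal t" "0 \<le> t"
      using T s1 s2 by (cases "infsum \<phi> (range h1 \<union> range h2)") (auto simp: top_unique simp flip: ennreal_plus)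
    have le: "ennreal (4 * p) \<le> ennreal (2 * s1 + 2 * q)" "ennreal s1 \<le> ennreal (8 * p + 2 * q)"
      "ennreal (4 * q) \<le> ennreal (2 * s2 + 2 * p)" "ennreal s2 \<le> ennreal (8 * q + 2 * p)"
      "ennreal t \<le> ennreal (s1 + s2)" "ennreal s1 \<le> ennreal t" "ennreal s2 \<le> ennreal t"
      using bounds T T1 T2 pq s1(2) s2(2) t(2) unfolding s1(1) s2(1) t(1)
      by (simp_all add: ennreal_mult')
    have le': "4 * p \<le> 2 * s1 + 2 * q" "s1 \<le> 8 * p + 2 * q"
      "4 * q \<le> 2 * s2 + 2 * p" "s2 \<le> 8 * q + 2 * p" "t \<le> s1 + s2" "s1 \<le> t" "s2 \<le> t"
      using le pq s1(2) s2(2) t(2) by (simp_all add: ennreal_le_iff del: ennreal_plus)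
    let ?T = "(\<Sum>\<^sub>\<infinity>lam\<in>range h1 \<union> range h2. ennreal ((cmod (L2_inner (measure_sum M N) f (expo lam)))\<^sup>2))"
    have "?T = ennreal t" using t(1) by (simp add: \<phi>_def[abs_def])
    moreover have "1/2 * (p + q) \<le> t" using le' by argo
    moreover have "t \<le> 10 * (p + q)" using le' by argo
    ultimately show "ennreal (1/2) * ennreal (L2_norm_sq (measure_sum M N) f) \<le> ?T"
      and "?T \<le> ennreal 10 * ennreal (L2_norm_sq (measure_sum M N) f)"
      unfolding norm by (simp_all only: ennreal_mult'[symmetric] ennreal_leI zero_le_numeral
          zero_le_divide_1_iff)
  qed
  have pos: "0 < ennreal c" "ennreal c < \<infinity>" if "0 < c" for c
    using that by simp_all
  have "countable (range h1 \<union> range h2)" by simp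
  then have "fourier_frame (measure_sum M N) (range h1 \<union> range h2)"
    unfolding fourier_frame_def using frame frame' pos[of "1/2"] pos[of 10]
    by (intro conjI exI[of _ "ennreal (1/2)"] exI[of _ "ennreal 10"] allI impI) (assumption | simp only:)+
  then show ?thesis by (auto simp: admits_fourier_frame_def)
qed

theorem theorem1p1:
  fixes i :: "'n::finite"
  assumes "CARD('n) \<ge> 3"
  shows "admits_fourier_frame (measure_sum (segment_measure i) (face_measure i))"
proof (rule admits_fourier_frame_measure_sum[of _ "{i}"])
  show "fourier_basis (segment_measure i) (coord_int_vecs {i})" by (rule fourier_basis_segment)
  show "fourier_basis (face_measure i) (coord_int_vecs (- {i}))" by (rule fourier_basis_face)
  show "AE x in segment_measure i. \<forall>j. j \<notin> {i} \<longrightarrow> x $ j = 0"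
    using AE_segment[of i] by eventually_elim (auto split: if_splits)
  show "AE x in face_measure i. \<forall>j. j \<in> {i} \<longrightarrow> x $ j = 0"
    using AE_face[of i] by eventually_elim (metis (mono_tags) singletonD)
  \<comment> \<open>The dimension bound provides a coordinate other than i, so the face has
    infinitely many frequencies.\<close>
  show "{i} \<noteq> UNIV"
  proof
    assume "{i} = UNIV"
    then have "CARD('n) = card {i}" by simp
    with assms show False by simp
  qed
qed simp

end
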